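(* Let $\phi:(\mathbb{P}^1)^3\dashrightarrow\mathbb{P}^3$ be a general trilinear birational map of type $(1,1,2)$. Then $\phi$ is pyramidal. Moreover, $$Y_0\cap Y_1=s\cup t\cup C,$$ where $s=\Sigma_0\cap\Sigma_1$, $t=T_0\cap T_1$, and $C$ is a plane conic that intersects both $s$ and $t$.
   Context: Setting. $\mathbb{P}^n$ is complex projective $n$-space. A trilinear rational map $\phi:\mathbb{P}^1\times\mathbb{P}^1\times\mathbb{P}^1\dashrightarrow\mathbb{P}^3$ is one given by $$\mathbf{f}=(f_0,f_1,f_2,f_3)=\sum_{0\le i,j,k\le 1} w_{ijk}\,\mathbf{P}_{ijk}\,s_it_ju_k,$$ with control points $\mathbf{P}_{ijk}=(1,x_{ijk},y_{ijk},z_{ijk})\in\mathbb{R}^4$ (identified with points of $\mathbb{P}^3$) and weights $w_{ijk}\in\mathbb{R}$. Boundary surfaces. $\Sigma_0$ (resp. $\Sigma_1$) is the closure of the image of $\phi$ restricted to $(s_0:s_1)=(1:0)$ (resp. $(0:1)$). $T_0,T_1$ and $Y_0,Y_1$ are defined in the same way using $(t_0:t_1)$ and $(u_0:u_1)$. Boundary lines: $s_{jk}$ joins $\mathbf{P}_{0jk},\mathbf{P}_{1jk}$; $t_{ik}$ joins $\mathbf{P}_{i0k},\mathbf{P}_{i1k}$; $u_{ij}$ joins $\mathbf{P}_{ij0},\mathbf{P}_{ij1}$ (images of the corresponding coordinate lines). The boundary surfaces and lines of the parameter $s$ (resp. $t$, $u$) are $\Sigma_i$ and $s_{jk}$ (resp.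 $T_j$ and $t_{ik}$; $Y_k$ and $u_{ij}$). $\phi$ is pyramidal if for one of the three parameters (1) the four boundary lines intersect at a point, and (2) the two boundary surfaces are quadrics. Type. If $\phi$ is birational, its inverse is $\mathbf{x}\mapsto(A_0:A_1)\times(B_0:B_1)\times(C_0:C_1)$ with $A_0,A_1$ (resp. $B_0,B_1$; $C_0,C_1$) homogeneous of the same degree in $\mathbf{x}=(x_0,\dots,x_3)$ without common factor; the type of $\phi$ is $(\deg A_i,\deg B_j,\deg C_k)$. The trilinear birational maps of a fixed type form an irreducible locus in the projective space $\mathbb{P}^{31}$ of trilinear rational maps (quadruples of trilinear forms up to scalar). "General" means belonging to a suitable nonempty Zariski-open subset of that locus; a general such map satisfies the nondegeneracy property that $\Sigma_i,T_j,Y_k$ are smooth surfaces, pairwise distinct, and $s_{jk},t_{ik},u_{ij}$ are lines, pairwise distinct. *)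

theory Defs
  imports
    "HOL-Analysis.Analysis"
    "HOL-Library.Poly_Mapping"
    "HOL-Computational_Algebra.Factorial_Ring"
begin

section \<open>Complex projective space\<close>

definition proj_rel :: "complex^'n \<Rightarrow> complex^'n \<Rightarrow> bool" where
  "proj_rel x y \<longleftrightarrow> x \<noteq> 0 \<and> y \<noteq> 0 \<and> (\<exists>c. c \<noteq> 0 \<and> y = c *s x)"

lemma part_equivp_proj_rel: "part_equivp (proj_rel :: complex^'n \<Rightarrow> complex^'n \<Rightarrow> bool)"
proof (rule part_equivpI)
  have "(vec 1 :: complex^'n) \<noteq> 0" by (simp add: vec_eq_iff)
  then have "proj_rel (vec 1 :: complex^'n) (vec 1)"
    unfolding proj_rel_def by (metis vector_smult_lid zero_neq_one)
  then show "\<exists>x :: complex^'n. proj_rel x x" by blast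
  show "symp (proj_rel :: complex^'n \<Rightarrow> _)"
  proof (rule sympI)
    fix x y :: "complex^'n"
    assume "proj_rel x y"
    then obtain c where c: "x \<noteq> 0" "y \<noteq> 0" "c \<noteq> 0" "y = c *s x"
      unfolding proj_rel_def by blast
    then have "x = inverse c *s y" by (simp add: vector_smult_assoc)
    then show "proj_rel y x" unfolding proj_rel_def
      using c by (metis inverse_nonzero_iff_nonzero)
  qed
  show "transp (proj_rel :: complex^'n \<Rightarrow> _)"
    by (rule transpI) (auto simp: proj_rel_def vector_smult_assoc)
qed

text \<open>The type \<open>'n proj\<close> is \<open>\<P>\<close> of the vector space \<open>complex^'n\<close>; thus \<open>2 proj\<close> is the
  projective line and \<open>4 proj\<close> is projective 3-space. \<open>point v\<close> is the class of \<open>v\<close> and is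
  meaningful only for \<open>v \<noteq> 0\<close>; \<open>coords p\<close> is some choice of homogeneous coordinates of \<open>p\<close>, and
  every notion below is independent of that choice.\<close>

quotient_type (overloaded) 'n proj = "complex^('n::finite)" / partial: proj_rel
  morphisms coords point
  by (rule part_equivp_proj_rel)

lemma coords_nonzero: "coords p \<noteq> 0"
  using Quotient_rep_reflp[OF Quotient_proj, of p] by (auto simp: proj_rel_def)

lemma point_coords [simp]: "point (coords p) = p"
  by (rule Quotient_abs_rep[OF Quotient_proj])

lemma point_eq_iff:
  assumes "x \<noteq> 0" "y \<noteq> 0"
  shows "point x = point y \<longleftrightarrow> (\<exists>c. c \<noteq> 0 \<and> y = c *s x)"
proof -
  have refl: "proj_rel z z" if "z \<noteq> 0" for z :: "complex^'n"
    unfolding proj_rel_def using that by (metis vector_smult_lid zero_neq_one)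
  show ?thesis
    using Quotient_rel[OF Quotient_proj, of x y] refl assms by (auto simp: proj_rel_def)
qed

section \<open>Polynomials and the Zariski topology\<close>

type_synonym 'n mpoly = "('n \<Rightarrow>\<^sub>0 nat) \<Rightarrow>\<^sub>0 complex"

definition eval :: "('n::finite) mpoly \<Rightarrow> complex^'n \<Rightarrow> complex" where
  "eval p x = (\<Sum>m\<in>Poly_Mapping.keys p.
     Poly_Mapping.lookup p m * (\<Prod>i\<in>UNIV. (x $ i) ^ Poly_Mapping.lookup m i))"

text \<open>The zero polynomial is homogeneous of every degree.\<close>

definition homogeneous :: "nat \<Rightarrow> ('n::finite) mpoly \<Rightarrow> bool" where
  "homogeneous d p \<longleftrightarrow>
     (\<forall>m\<in>Poly_Mapping.keys p. (\<Sum>i\<in>UNIV. Poly_Mapping.lookup m i) = d)"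

lemma eval_homogeneous_smult:
  assumes "homogeneous d p"
  shows "eval p (c *s x) = c ^ d * eval p x"
proof -
  have "(\<Prod>i\<in>UNIV. ((c *s x) $ i) ^ Poly_Mapping.lookup m i)
        = c ^ d * (\<Prod>i\<in>UNIV. (x $ i) ^ Poly_Mapping.lookup m i)"
    if "m \<in> Poly_Mapping.keys p" for m
    using assms that
    by (simp add: homogeneous_def power_mult_distrib prod.distrib flip: power_sum)
  then show ?thesis
    unfolding eval_def by (simp add: sum_distrib_left algebra_simps)
qed

definition zero_locus :: "('n::finite) mpoly set \<Rightarrow> 'n proj set" where
  "zero_locus S = {x. \<forall>p\<in>S. eval p (coords x) = 0}"

definition zariski_closed :: "('n::finite) proj set \<Rightarrow> bool" where
  "zariski_closed Z \<longleftrightarrow> (\<exists>S. (\<forall>p\<in>S. \<exists>d. homogeneous d p) \<and> Z = zero_locus S)"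

definition zariski_open :: "('n::finite) proj set \<Rightarrow> bool" where
  "zariski_open U \<longleftrightarrow> zariski_closed (- U)"

definition no_common_factor :: "('n::finite) mpoly \<Rightarrow> 'n mpoly \<Rightarrow> bool" where
  "no_common_factor p q \<longleftrightarrow> (\<forall>g. g dvd p \<longrightarrow> g dvd q \<longrightarrow> g dvd 1)"

definition join :: "('n::finite) proj \<Rightarrow> 'n proj \<Rightarrow> 'n proj set" where
  "join p q = {point (a *s coords p + b *s coords q) |a b. a *s coords p + b *s coords q \<noteq> 0}"

text \<open>Irreducibility of the equation excludes in particular a plane counted twice.\<close>

definition quadric_surface :: "4 proj set \<Rightarrow> bool" where
  "quadric_surface X \<longleftrightarrow> (\<exists>q. homogeneous 2 q \<and> irreducible q \<and> X = zero_locus {q})"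

text \<open>The last condition says that the restriction of \<open>q\<close> to the plane \<open>l = 0\<close> is an irreducible
  quadratic form, so that the conic is neither the whole plane, nor a double line, nor a pair of
  lines.\<close>

definition plane_conic :: "4 proj set \<Rightarrow> bool" where
  "plane_conic C \<longleftrightarrow> (\<exists>l q. homogeneous 1 l \<and> l \<noteq> 0 \<and> homogeneous 2 q \<and> C = zero_locus {l, q} \<and>
     (\<forall>a b. homogeneous 1 a \<and> homogeneous 1 b \<longrightarrow> \<not> l dvd (q - a * b)))"

section \<open>Trilinear rational maps\<close>

text \<open>A quadruple of trilinear forms up to scalar is a point of the projective space of dimension
  31 whose coordinate of index \<open>(i, j, k, l)\<close> is the coefficient of \<open>s\<^sub>i t\<^sub>j u\<^sub>k\<close> in the \<open>l\<close>-th form.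
  The indices in the types \<open>2\<close> and \<open>4\<close> run over \<open>0, 1\<close> and \<open>0, 1, 2, 3\<close>.\<close>

type_synonym trilinear_map = "(2 \<times> 2 \<times> 2 \<times> 4) proj"

text \<open>The vector \<open>w\<^sub>i\<^sub>j\<^sub>k P\<^sub>i\<^sub>j\<^sub>k\<close>.\<close>

definition coeff_vec :: "trilinear_map \<Rightarrow> 2 \<Rightarrow> 2 \<Rightarrow> 2 \<Rightarrow> complex^4" where
  "coeff_vec \<phi> i j k = (\<chi> l. coords \<phi> $ (i, j, k, l))"

definition trilinear :: "trilinear_map \<Rightarrow> complex^2 \<Rightarrow> complex^2 \<Rightarrow> complex^2 \<Rightarrow> complex^4" where
  "trilinear \<phi> s t u =
     (\<Sum>i\<in>UNIV. \<Sum>j\<in>UNIV. \<Sum>k\<in>UNIV. (s $ i * t $ j * u $ k) *s coeff_vec \<phi> i j k)"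

text \<open>The point \<open>P\<^sub>i\<^sub>j\<^sub>k\<close> of projective space; it is determined by the map only if the weight
  \<open>w\<^sub>i\<^sub>j\<^sub>k\<close> is nonzero.\<close>

definition control_point :: "trilinear_map \<Rightarrow> 2 \<Rightarrow> 2 \<Rightarrow> 2 \<Rightarrow> 4 proj" where
  "control_point \<phi> i j k = point (coeff_vec \<phi> i j k)"

text \<open>The maps given by real weights and control points \<open>(1, x, y, z)\<close> with real \<open>x, y, z\<close>.\<close>

definition real_trilinear_maps :: "trilinear_map set" where
  "real_trilinear_maps =
     {point (vec_lambda (\<lambda>(i, j, k, l). complex_of_real (w i j k * P i j k $ l))) |
        (w :: 2 \<Rightarrow> 2 \<Rightarrow> 2 \<Rightarrow> real) (P :: 2 \<Rightarrow> 2 \<Rightarrow> 2 \<Rightarrow> real^4).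
        (\<exists>i j k. w i j k \<noteq> 0) \<and> (\<forall>i j k. P i j k $ 0 = 1)}"

subsection \<open>Birationality and type\<close>

definition eval_pair :: "(2 \<Rightarrow> ('n::finite) mpoly) \<Rightarrow> complex^'n \<Rightarrow> complex^2" where
  "eval_pair A x = (\<chi> i. eval (A i) x)"

text \<open>The rational maps \<open>\<phi>\<close> and \<open>x \<mapsto> (A\<^sub>0:A\<^sub>1) \<times> (B\<^sub>0:B\<^sub>1) \<times> (C\<^sub>0:C\<^sub>1)\<close> are mutually inverse: each of
  the two composites is defined somewhere, and is the identity wherever it is defined.\<close>

definition is_inverse ::
    "trilinear_map \<Rightarrow> (2 \<Rightarrow> 4 mpoly) \<Rightarrow> (2 \<Rightarrow> 4 mpoly) \<Rightarrow> (2 \<Rightarrow> 4 mpoly) \<Rightarrow> bool" where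
  "is_inverse \<phi> A B C \<longleftrightarrow>
     (let f = trilinear \<phi>; \<alpha> = eval_pair A; \<beta> = eval_pair B; \<gamma> = eval_pair C;
          defd = (\<lambda>x. x \<noteq> 0 \<and> \<alpha> x \<noteq> 0 \<and> \<beta> x \<noteq> 0 \<and> \<gamma> x \<noteq> 0) in
      (\<exists>s t u. defd (f s t u)) \<and>
      (\<forall>s t u. defd (f s t u) \<longrightarrow>
         point (\<alpha> (f s t u)) = point s \<and> point (\<beta> (f s t u)) = point t \<and>
         point (\<gamma> (f s t u)) = point u) \<and>
      (\<exists>x. defd x \<and> f (\<alpha> x) (\<beta> x) (\<gamma> x) \<noteq> 0) \<and>
      (\<forall>x. defd x \<and> f (\<alpha> x) (\<beta> x) (\<gamma> x) \<noteq> 0 \<longrightarrow> point (f (\<alpha> x) (\<beta> x) (\<gamma> x)) = point x))"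

definition birational_of_type :: "nat \<times> nat \<times> nat \<Rightarrow> trilinear_map set" where
  "birational_of_type = (\<lambda>(a, b, c). {\<phi>. \<exists>A B C.
     (\<forall>i. homogeneous a (A i)) \<and> no_common_factor (A 0) (A 1) \<and>
     (\<forall>i. homogeneous b (B i)) \<and> no_common_factor (B 0) (B 1) \<and>
     (\<forall>i. homogeneous c (C i)) \<and> no_common_factor (C 0) (C 1) \<and>
     is_inverse \<phi> A B C})"

subsection \<open>Boundary surfaces and lines\<close>

text \<open>\<open>axis 0 1\<close> and \<open>axis 1 1\<close> are the parameter values \<open>(1:0)\<close> and \<open>(0:1)\<close>.\<close>

definition surf_S :: "trilinear_map \<Rightarrow> 2 \<Rightarrow> 4 proj set" where
  "surf_S \<phi> i = zariski_closed hull
     {point (trilinear \<phi> (axis i 1) t u) |t u. trilinear \<phi> (axis i 1) t u \<noteq> 0}"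

definition surf_T :: "trilinear_map \<Rightarrow> 2 \<Rightarrow> 4 proj set" where
  "surf_T \<phi> j = zariski_closed hull
     {point (trilinear \<phi> s (axis j 1) u) |s u. trilinear \<phi> s (axis j 1) u \<noteq> 0}"

definition surf_Y :: "trilinear_map \<Rightarrow> 2 \<Rightarrow> 4 proj set" where
  "surf_Y \<phi> k = zariski_closed hull
     {point (trilinear \<phi> s t (axis k 1)) |s t. trilinear \<phi> s t (axis k 1) \<noteq> 0}"

definition line_s :: "trilinear_map \<Rightarrow> 2 \<Rightarrow> 2 \<Rightarrow> 4 proj set" where
  "line_s \<phi> j k = join (control_point \<phi> 0 j k) (control_point \<phi> 1 j k)"

definition line_t :: "trilinear_map \<Rightarrow> 2 \<Rightarrow> 2 \<Rightarrow> 4 proj set" where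
  "line_t \<phi> i k = join (control_point \<phi> i 0 k) (control_point \<phi> i 1 k)"

definition line_u :: "trilinear_map \<Rightarrow> 2 \<Rightarrow> 2 \<Rightarrow> 4 proj set" where
  "line_u \<phi> i j = join (control_point \<phi> i j 0) (control_point \<phi> i j 1)"

definition pyramidal :: "trilinear_map \<Rightarrow> bool" where
  "pyramidal \<phi> \<longleftrightarrow>
     ((\<exists>p. (\<Inter>j. \<Inter>k. line_s \<phi> j k) = {p}) \<and> (\<forall>i. quadric_surface (surf_S \<phi> i))) \<or>
     ((\<exists>p. (\<Inter>i. \<Inter>k. line_t \<phi> i k) = {p}) \<and> (\<forall>j. quadric_surface (surf_T \<phi> j))) \<or>
     ((\<exists>p. (\<Inter>i. \<Inter>j. line_u \<phi> i j) = {p}) \<and> (\<forall>k. quadric_surface (surf_Y \<phi> k)))"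

end

theory Submission
  imports Defs
begin

text \<open>The boundary faces \<open>Y\<^sub>k\<close> of a general map are Segre quadrics, so the coefficient vectors
  \<open>e\<^sub>i\<^sub>j = w\<^sub>i\<^sub>j\<^sub>0 P\<^sub>i\<^sub>j\<^sub>0\<close> form a basis; let \<open>y\<^sub>i\<^sub>j\<close> be the coordinates in it. Linearity of the first two
  components of the inverse means that they are \<open>y g\<close> and \<open>h y\<close> for the matrix \<open>y\<close> and vectors
  \<open>g\<close>, \<open>h\<close>. Both pencils of planes contain the plane \<open>\<tau> = h y g = 0\<close>, so their axes meet, in the
  apex \<open>o\<close> with coordinate matrix \<open>o\<^sub>i\<^sub>j = \<plusminus> h\<^sub>1\<^sub>-\<^sub>i g\<^sub>1\<^sub>-\<^sub>j\<close>. The line \<open>u\<^sub>i\<^sub>j\<close> is an intersection of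
  planes of the two pencils and thus passes through \<open>o\<close>. This forces
  \<open>w\<^sub>i\<^sub>j\<^sub>1 P\<^sub>i\<^sub>j\<^sub>1 = \<mu> e\<^sub>i\<^sub>j + c\<^sub>i\<^sub>j o\<close>. With \<open>\<sigma> = \<Sum> c\<^sub>i\<^sub>j y\<^sub>i\<^sub>j\<close> one finds that \<open>Y\<^sub>0\<close> is \<open>det y = 0\<close> and
  \<open>Y\<^sub>1\<close> is \<open>(\<mu> + \<sigma>(o)) det y = \<sigma> \<tau>\<close>; the tangent plane \<open>\<tau> = 0\<close> cuts \<open>det y = 0\<close> in the two axes
  and the plane \<open>\<sigma> = 0\<close> cuts it in the conic.\<close>

section \<open>Polynomials\<close>

lemma sum_single_keys:
  fixes p :: "'a \<Rightarrow>\<^sub>0 'b::comm_monoid_add"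
  shows "(\<Sum>m\<in>Poly_Mapping.keys p. Poly_Mapping.single m (Poly_Mapping.lookup p m)) = p"
proof (rule poly_mapping_eqI)
  fix k
  show "Poly_Mapping.lookup (\<Sum>m\<in>Poly_Mapping.keys p.
      Poly_Mapping.single m (Poly_Mapping.lookup p m)) k = Poly_Mapping.lookup p k"
    by (cases "k \<in> Poly_Mapping.keys p")
      (auto simp: lookup_sum lookup_single when_def sum.delta' in_keys_iff)
qed

section \<open>Evaluation as a ring homomorphism\<close>

lemma eval_single:
  "eval (Poly_Mapping.single m c) x = c * (\<Prod>i\<in>UNIV. (x $ i) ^ Poly_Mapping.lookup m i)"
  by (simp add: eval_def)

lemma eval_0 [simp]: "eval 0 x = 0"
  by (simp add: eval_def)

lemma eval_1 [simp]: "eval 1 x = 1"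
  by (simp add: eval_single flip: single_one)

lemma eval_add [simp]: "eval (p + q) x = eval p x + eval q x"
  unfolding eval_def by (rule setsum_keys_plus_distrib) (auto simp: algebra_simps)

lemma eval_sum [simp]: "eval (sum f S) x = (\<Sum>i\<in>S. eval (f i) x)"
  by (induction S rule: infinite_finite_induct) auto

lemma eval_uminus [simp]: "eval (- p) x = - eval p x"
  using eval_add[of p "- p" x] by (simp add: eq_neg_iff_add_eq_0 add.commute)

lemma eval_diff [simp]: "eval (p - q) x = eval p x - eval q x"
  using eval_add[of p "- q" x] by simp

text \<open>Writing both factors as sums of monomials by \<open>sum_single_keys\<close> reduces the
  claim, by bilinearity, to monomials, whose exponents add.\<close>

lemma eval_mult [simp]: "eval (p * q) x = eval p x * eval q x"
proof -
  have single: "eval (Poly_Mapping.single m c * Poly_Mapping.single n d) x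
      = eval (Poly_Mapping.single m c) x * eval (Poly_Mapping.single n d) x" for m n c d
    by (simp add: mult_single eval_single lookup_add power_add prod.distrib)
  have "eval ((\<Sum>m\<in>Poly_Mapping.keys p. Poly_Mapping.single m (Poly_Mapping.lookup p m)) *
      (\<Sum>n\<in>Poly_Mapping.keys q. Poly_Mapping.single n (Poly_Mapping.lookup q n))) x
    = eval (\<Sum>m\<in>Poly_Mapping.keys p. Poly_Mapping.single m (Poly_Mapping.lookup p m)) x *
      eval (\<Sum>n\<in>Poly_Mapping.keys q. Poly_Mapping.single n (Poly_Mapping.lookup q n)) x"
    by (simp add: sum_product single)
  then show ?thesis by (simp add: sum_single_keys)
qed

lemma eval_prod [simp]: "eval (prod f S) x = (\<Prod>i\<in>S. eval (f i) x)"
  by (induction S rule: infinite_finite_induct) auto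

lemma eval_of_int [simp]: "eval (of_int n) x = of_int n"
  by (simp add: eval_single flip: single_of_int)

lemma eval_det [simp]:
  fixes M :: "('n::finite mpoly)^'m^'m"
  shows "eval (det M) x = det (\<chi> i j. eval (M $ i $ j) x)"
  by (simp add: det_def)

section \<open>Homogeneous forms\<close>

lemma homogeneous_0 [simp]: "homogeneous d 0"
  by (simp add: homogeneous_def)

lemma homogeneous_add: "homogeneous d p \<Longrightarrow> homogeneous d q \<Longrightarrow> homogeneous d (p + q)"
  using keys_add[of p q] by (auto simp: homogeneous_def)

lemma homogeneous_sum: "(\<And>i. i \<in> S \<Longrightarrow> homogeneous d (f i)) \<Longrightarrow> homogeneous d (sum f S)"
  by (induction S rule: infinite_finite_induct) (auto intro: homogeneous_add)

lemma homogeneous_diff: "homogeneous d p \<Longrightarrow> homogeneous d q \<Longrightarrow> homogeneous d (p - q)"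
  using homogeneous_add[of d p "- q"] by (simp add: homogeneous_def)

lemma homogeneous_mult:
  "homogeneous d p \<Longrightarrow> homogeneous e q \<Longrightarrow> homogeneous (d + e) (p * q)"
  using keys_mult[of p q] by (fastforce simp: homogeneous_def lookup_add sum.distrib)

lemma homogeneous_single:
  "(\<Sum>i\<in>UNIV. Poly_Mapping.lookup m i) = d \<Longrightarrow> homogeneous d (Poly_Mapping.single m c)"
  by (auto simp: homogeneous_def)

lemma homogeneous_of_int: "homogeneous 0 (of_int n)"
  unfolding single_of_int[symmetric] by (rule homogeneous_single) simp

lemma homogeneous_prod:
  "(\<And>i. i \<in> S \<Longrightarrow> homogeneous (d i) (f i)) \<Longrightarrow> homogeneous (sum d S) (prod f S)"
proof (induction S rule: infinite_finite_induct)
  case (insert i S)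
  then show ?case by (simp add: homogeneous_mult)
qed (use homogeneous_of_int[of 1] in auto)

lemma homogeneous_det:
  fixes M :: "('n::finite mpoly)^'m^'m"
  assumes "\<And>i j. homogeneous 1 (M $ i $ j)"
  shows "homogeneous CARD('m) (det M)"
proof -
  have "homogeneous (0 + (\<Sum>i\<in>(UNIV::'m set). 1)) (of_int (sign p) * (\<Prod>i\<in>UNIV. M $ i $ p i))"
    for p by (intro homogeneous_mult homogeneous_of_int homogeneous_prod assms)
  then show ?thesis
    unfolding det_def by (intro homogeneous_sum) simp
qed

definition coord :: "'n \<Rightarrow> ('n::finite) mpoly" where
  "coord i = Poly_Mapping.single (Poly_Mapping.single i 1) 1"

lemma homogeneous_coord: "homogeneous 1 (coord i)"
  by (auto simp: coord_def homogeneous_def lookup_single when_def sum.delta)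

lemma eval_coord [simp]: "eval (coord i) x = x $ i"
proof -
  have "(\<Prod>j\<in>UNIV. (x $ j) ^ Poly_Mapping.lookup (Poly_Mapping.single i 1) j)
    = (\<Prod>j\<in>UNIV. if j = i then x $ i else 1)"
    by (rule prod.cong) (auto simp: lookup_single)
  then show ?thesis by (simp add: coord_def eval_single)
qed

definition const :: "complex \<Rightarrow> ('n::finite) mpoly" where
  "const c = Poly_Mapping.single 0 c"

lemma homogeneous_const: "homogeneous 0 (const c)"
  by (simp add: const_def homogeneous_single)

lemma eval_const [simp]: "eval (const c) x = c"
  by (simp add: const_def eval_single)

lemma homogeneous_0_imp_const:
  assumes "homogeneous 0 p"
  obtains c where "p = const c"
proof -
  have "m = 0" if "m \<in> Poly_Mapping.keys p" for m
    using assms that by (auto simp: homogeneous_def intro: poly_mapping_eqI)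
  then have "Poly_Mapping.keys p \<subseteq> {0}" by auto
  then have "p = const (Poly_Mapping.lookup p 0)"
    by (intro poly_mapping_eqI) (auto simp: const_def lookup_single when_def in_keys_iff)
  then show thesis by (rule that)
qed

lemma const_dvd_1: "c \<noteq> 0 \<Longrightarrow> const c dvd 1"
  by (rule dvdI[of _ _ "const (inverse c)"]) (simp add: const_def mult_single)

definition linform :: "complex^'n \<Rightarrow> ('n::finite) mpoly" where
  "linform w = (\<Sum>l\<in>UNIV. const (w $ l) * coord l)"

text \<open>The pairing is bilinear, with no complex conjugation, so that coefficient vectors can
  stand for linear forms.\<close>

definition lin :: "complex^'n \<Rightarrow> complex^('n::finite) \<Rightarrow> complex" where
  "lin w x = (\<Sum>l\<in>UNIV. w $ l * x $ l)"

lemma eval_linform [simp]: "eval (linform w) x = lin w x"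
  by (simp add: linform_def lin_def)

lemma homogeneous_linform: "homogeneous 1 (linform w)"
  unfolding linform_def
  using homogeneous_mult[OF homogeneous_const homogeneous_coord]
  by (intro homogeneous_sum) simp

lemma lin_0 [simp]: "lin w 0 = 0"
  by (simp add: lin_def)

lemma lin_add [simp]: "lin w (x + y) = lin w x + lin w y"
  by (simp add: lin_def distrib_left sum.distrib)

lemma lin_smult [simp]: "lin w (c *s x) = c * lin w x"
  by (simp add: lin_def sum_distrib_left algebra_simps)

lemma lin_diff [simp]: "lin w (x - y) = lin w x - lin w y"
  by (simp add: lin_def right_diff_distrib sum_subtractf)

lemma lin_sum [simp]: "lin w (sum f S) = (\<Sum>i\<in>S. lin w (f i))"
  by (induction S rule: infinite_finite_induct) auto

lemma lin_add_left [simp]: "lin (v + w) x = lin v x + lin w x"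
  by (simp add: lin_def distrib_right sum.distrib)

lemma lin_sum_left [simp]: "lin (sum f S) x = (\<Sum>i\<in>S. lin (f i) x)"
  by (induction S rule: infinite_finite_induct) (auto simp: lin_def distrib_right sum.distrib)

lemma lin_smult_left [simp]: "lin (c *s w) x = c * lin w x"
  by (simp add: lin_def sum_distrib_left algebra_simps)

lemma lin_diff_left [simp]: "lin (v - w) x = lin v x - lin w x"
  by (simp add: lin_def left_diff_distrib sum_subtractf)

text \<open>Natural exponents that sum to 1 leave a single variable, so every monomial is a scaled
  coordinate.\<close>

lemma homogeneous_1_eval:
  assumes "homogeneous 1 p"
  obtains w where "\<And>x. eval p x = lin w x"
proof -
  have unit: "\<exists>i. m = Poly_Mapping.single i 1" if m: "m \<in> Poly_Mapping.keys p" for m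
  proof -
    have 1: "(\<Sum>i\<in>UNIV. Poly_Mapping.lookup m i) = 1"
      using assms m by (auto simp: homogeneous_def)
    then obtain i where "Poly_Mapping.lookup m i = 1"
      "\<And>j. j \<noteq> i \<Longrightarrow> Poly_Mapping.lookup m j = 0"
      by (subst (asm) sum_eq_1_iff) auto
    then have "m = Poly_Mapping.single i 1"
      by (intro poly_mapping_eqI) (auto simp: lookup_single when_def)
    then show ?thesis by blast
  qed
  have "\<exists>w. \<forall>x. eval (Poly_Mapping.single m (Poly_Mapping.lookup p m)) x = lin w x"
    if m: "m \<in> Poly_Mapping.keys p" for m
  proof -
    obtain i where "m = Poly_Mapping.single i 1" using unit[OF m] by blast
    then have "Poly_Mapping.single m (Poly_Mapping.lookup p m)
        = const (Poly_Mapping.lookup p m) * coord i"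
      by (simp add: const_def coord_def mult_single)
    then have "eval (Poly_Mapping.single m (Poly_Mapping.lookup p m)) x
        = lin (axis i (Poly_Mapping.lookup p m)) x" for x
      by (simp add: lin_def axis_def if_distrib[of "\<lambda>c. c * _"] cong: if_cong)
    then show ?thesis by blast
  qed
  then obtain w where w: "\<And>m x. m \<in> Poly_Mapping.keys p \<Longrightarrow>
      eval (Poly_Mapping.single m (Poly_Mapping.lookup p m)) x = lin (w m) x"
    by metis
  have "eval p x = lin (\<Sum>m\<in>Poly_Mapping.keys p. w m) x" for x
    using eval_sum[of _ "Poly_Mapping.keys p" x] by (subst sum_single_keys[of p, symmetric])
      (simp add: w)
  then show thesis by (rule that)
qed

subsection \<open>Factors of homogeneous polynomials\<close>

abbreviation tdeg :: "('n::finite \<Rightarrow>\<^sub>0 nat) \<Rightarrow> nat" where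
  "tdeg m \<equiv> (\<Sum>i\<in>UNIV. Poly_Mapping.lookup m i)"

lemma split_degree:
  fixes p :: "('n::finite) mpoly"
  assumes "d \<in> tdeg ` Poly_Mapping.keys p"
  obtains p1 p2 where "p = p1 + p2" "p1 \<noteq> 0" "homogeneous d p1"
    "Poly_Mapping.keys p2 \<subseteq> {m \<in> Poly_Mapping.keys p. tdeg m \<noteq> d}"
proof
  let ?s = "\<lambda>m. Poly_Mapping.single m (Poly_Mapping.lookup p m)"
  let ?K = "{m \<in> Poly_Mapping.keys p. tdeg m = d}"
  let ?L = "{m \<in> Poly_Mapping.keys p. tdeg m \<noteq> d}"
  have K: "Poly_Mapping.keys p = ?K \<union> ?L" by auto
  have "p = sum ?s (?K \<union> ?L)" using K sum_single_keys[of p] by simp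
  also have "\<dots> = sum ?s ?K + sum ?s ?L" by (rule sum.union_disjoint) auto
  finally show "p = sum ?s ?K + sum ?s ?L" .
  have lookup: "Poly_Mapping.lookup (sum ?s S) k = (if k \<in> S then Poly_Mapping.lookup p k else 0)"
    if "finite S" for S k
    using that by (simp add: lookup_sum lookup_single when_def sum.delta')
  obtain m where m: "m \<in> ?K" using assms by auto
  then have "Poly_Mapping.lookup (sum ?s ?K) m \<noteq> 0" by (subst lookup) (auto simp: in_keys_iff)
  then show "sum ?s ?K \<noteq> 0" by auto
  show "homogeneous d (sum ?s ?K)" by (intro homogeneous_sum homogeneous_single) auto
  show "Poly_Mapping.keys (sum ?s ?L) \<subseteq> ?L"
  proof
    fix k assume "k \<in> Poly_Mapping.keys (sum ?s ?L)"
    then have "Poly_Mapping.lookup (sum ?s ?L) k \<noteq> 0" by (simp add: in_keys_iff)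
    then show "k \<in> ?L" by (subst (asm) lookup) (auto split: if_splits)
  qed
qed

text \<open>Only the pair \<open>d\<close>, \<open>e\<close> of degrees sums to
  \<open>d + e\<close>, so the part of that degree in the product is \<open>p1 * q1\<close>. It is
  nonzero because polynomials in linearly ordered variables form an integral domain.\<close>

lemma extremal_degree_mult:
  fixes p q :: "('n::{finite,linorder}) mpoly"
  assumes d: "d \<in> tdeg ` Poly_Mapping.keys p" and e: "e \<in> tdeg ` Poly_Mapping.keys q"
    and extremal: "\<And>m n. m \<in> Poly_Mapping.keys p \<Longrightarrow> n \<in> Poly_Mapping.keys q \<Longrightarrow>
      tdeg m + tdeg n = d + e \<Longrightarrow> tdeg m = d \<and> tdeg n = e"
  shows "d + e \<in> tdeg ` Poly_Mapping.keys (p * q)"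
proof -
  obtain p1 p2 where p: "p = p1 + p2" "p1 \<noteq> 0" "homogeneous d p1"
    "Poly_Mapping.keys p2 \<subseteq> {m \<in> Poly_Mapping.keys p. tdeg m \<noteq> d}" using split_degree[OF d] .
  obtain q1 q2 where q: "q = q1 + q2" "q1 \<noteq> 0" "homogeneous e q1"
    "Poly_Mapping.keys q2 \<subseteq> {m \<in> Poly_Mapping.keys q. tdeg m \<noteq> e}" using split_degree[OF e] .
  have "p1 * q1 \<noteq> 0" using p q by simp
  then obtain m where m: "m \<in> Poly_Mapping.keys (p1 * q1)" by (metis keys_eq_empty ex_in_conv)
  have deg: "tdeg m = d + e" using homogeneous_mult[OF p(3) q(3)] m by (simp add: homogeneous_def)
  have p1: "Poly_Mapping.keys p1 \<subseteq> Poly_Mapping.keys p"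
  proof -
    have "p1 = p + - p2" using p by simp
    then have "Poly_Mapping.keys p1 \<subseteq> Poly_Mapping.keys p \<union> Poly_Mapping.keys (- p2)"
      by (metis keys_add)
    then show ?thesis using p(4) by auto
  qed
  have "m \<notin> Poly_Mapping.keys (p1 * q2 + p2 * q)"
  proof
    assume "m \<in> Poly_Mapping.keys (p1 * q2 + p2 * q)"
    with keys_add have "m \<in> Poly_Mapping.keys (p1 * q2) \<union> Poly_Mapping.keys (p2 * q)"
      by (rule subsetD)
    then have "m \<in> {a + b |a b. a \<in> Poly_Mapping.keys p1 \<and> b \<in> Poly_Mapping.keys q2} \<union>
        {a + b |a b. a \<in> Poly_Mapping.keys p2 \<and> b \<in> Poly_Mapping.keys q}"
      by (rule subsetD[OF Un_mono[OF keys_mult keys_mult]])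
    then obtain a b where ab: "m = a + b" "a \<in> Poly_Mapping.keys p" "b \<in> Poly_Mapping.keys q"
      "tdeg a \<noteq> d \<or> tdeg b \<noteq> e"
      using p1 p(4) q(4) by fastforce
    then have "tdeg a + tdeg b = d + e" using deg by (simp add: lookup_add sum.distrib)
    then show False using extremal ab by blast
  qed
  moreover have "p * q = p1 * q1 + (p1 * q2 + p2 * q)" by (simp add: p(1) q(1) algebra_simps)
  ultimately have "m \<in> Poly_Mapping.keys (p * q)" using m by (simp add: in_keys_iff lookup_add)
  then show ?thesis using deg by (metis imageI)
qed

text \<open>The largest degrees of the two factors add up to a degree of the product, and so do the
  smallest. The product has a single degree, so largest and smallest agree in each factor.\<close>

lemma homogeneous_factors:
  fixes p q :: "('n::{finite,linorder}) mpoly"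
  assumes hom: "homogeneous n (p * q)" and nz: "p * q \<noteq> 0"
  obtains d e where "n = d + e" "homogeneous d p" "homogeneous e q"
proof -
  let ?P = "tdeg ` Poly_Mapping.keys p" and ?Q = "tdeg ` Poly_Mapping.keys q"
  have ne: "?P \<noteq> {}" "?Q \<noteq> {}" using nz by auto
  have bounds: "m \<le> Max ?P" "m' \<le> Max ?Q" "Min ?P \<le> m" "Min ?Q \<le> m'"
    if "m \<in> ?P" "m' \<in> ?Q" for m m'
    by (intro Max_ge Min_le finite_imageI finite_keys that)+
  have "Max ?P + Max ?Q \<in> tdeg ` Poly_Mapping.keys (p * q)"
  proof (rule extremal_degree_mult)
    fix a b assume "a \<in> Poly_Mapping.keys p" "b \<in> Poly_Mapping.keys q"
      "tdeg a + tdeg b = Max ?P + Max ?Q"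
    then show "tdeg a = Max ?P \<and> tdeg b = Max ?Q"
      using bounds(1,2)[OF imageI imageI, of a b] by linarith
  qed (intro Max_in finite_imageI finite_keys ne)+
  then have max: "Max ?P + Max ?Q = n" using hom by (auto simp: homogeneous_def)
  have "Min ?P + Min ?Q \<in> tdeg ` Poly_Mapping.keys (p * q)"
  proof (rule extremal_degree_mult)
    fix a b assume "a \<in> Poly_Mapping.keys p" "b \<in> Poly_Mapping.keys q"
      "tdeg a + tdeg b = Min ?P + Min ?Q"
    then show "tdeg a = Min ?P \<and> tdeg b = Min ?Q"
      using bounds(3,4)[OF imageI imageI, of a b] by linarith
  qed (intro Min_in finite_imageI finite_keys ne)+
  then have min: "Min ?P + Min ?Q = n" using hom by (auto simp: homogeneous_def)
  obtain a b where ab: "a \<in> ?P" "b \<in> ?Q" using ne by blast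
  have eq: "m = Max ?P" "m' = Max ?Q" if "m \<in> ?P" "m' \<in> ?Q" for m m'
    using bounds[OF that] bounds[OF ab] max min by linarith+
  have "homogeneous (Max ?P) p" "homogeneous (Max ?Q) q"
    unfolding homogeneous_def using eq(1)[OF imageI ab(2)] eq(2)[OF ab(1) imageI] by auto
  then show thesis using max that by metis
qed

lemma homogeneous_1_irreducible:
  fixes p :: "('n::{finite,linorder}) mpoly"
  assumes "homogeneous 1 p" "p \<noteq> 0"
  shows "irreducible p"
proof (rule irreducibleI)
  show "\<not> p dvd 1"
  proof
    assume "p dvd 1"
    then obtain q where "1 = p * q" by (auto simp: dvd_def)
    then have "eval p 0 * eval q 0 = 1" by (metis eval_1 eval_mult)
    moreover have "eval p 0 = 0" using eval_homogeneous_smult[OF assms(1), of 0 0] by simp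
    ultimately show False by simp
  qed
  fix a b assume ab: "p = a * b"
  then obtain d e where de: "1 = d + e" "homogeneous d a" "homogeneous e b"
    using homogeneous_factors[of 1 a b] assms by metis
  then consider "d = 0" | "e = 0" by linarith
  then show "a dvd 1 \<or> b dvd 1"
  proof cases
    case 1
    then obtain c where "a = const c" using de homogeneous_0_imp_const by metis
    then show ?thesis using const_dvd_1 ab assms(2) by (cases "c = 0") (auto simp: const_def)
  next
    case 2
    then obtain c where "b = const c" using de homogeneous_0_imp_const by metis
    then show ?thesis using const_dvd_1 ab assms(2) by (cases "c = 0") (auto simp: const_def)
  qed
qed (use assms in auto)

text \<open>The degrees of two factors are 0 and 2, which makes one of them constant, or 1 and 1,
  which makes the quadratic function a product of two linear ones.\<close>

lemma homogeneous_2_irreducible: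
  fixes p :: "('n::{finite,linorder}) mpoly"
  assumes "homogeneous 2 p" "p \<noteq> 0"
    and no_lin: "\<And>v w. \<not> (\<forall>x. eval p x = lin v x * lin w x)"
  shows "irreducible p"
proof (rule irreducibleI)
  show "\<not> p dvd 1"
  proof
    assume "p dvd 1"
    then obtain q where "1 = p * q" by (auto simp: dvd_def)
    then have "eval p 0 * eval q 0 = 1" by (metis eval_1 eval_mult)
    moreover have "eval p 0 = 0" using eval_homogeneous_smult[OF assms(1), of 0 0] by simp
    ultimately show False by simp
  qed
  fix a b assume ab: "p = a * b"
  then obtain d e where de: "2 = d + e" "homogeneous d a" "homogeneous e b"
    using homogeneous_factors[of 2 a b] assms by metis
  then consider "d = 0" | "e = 0" | "d = 1" "e = 1" by linarith
  then show "a dvd 1 \<or> b dvd 1"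
  proof cases
    case 1
    then obtain c where "a = const c" using de homogeneous_0_imp_const by metis
    then show ?thesis using const_dvd_1 ab assms(2) by (cases "c = 0") (auto simp: const_def)
  next
    case 2
    then obtain c where "b = const c" using de homogeneous_0_imp_const by metis
    then show ?thesis using const_dvd_1 ab assms(2) by (cases "c = 0") (auto simp: const_def)
  next
    case 3
    then obtain v w where "\<And>x. eval a x = lin v x" "\<And>x. eval b x = lin w x"
      using de homogeneous_1_eval by metis
    then show ?thesis using no_lin[of v w] ab by simp
  qed
qed (use assms in auto)

text \<open>A common divisor that is not a unit is associated to \<open>p\<close>; then
  \<open>p\<close> divides \<open>q\<close>, and \<open>q\<close> vanishes wherever \<open>p\<close>
  does.\<close>

lemma no_common_factorI:
  assumes "irreducible p" "eval p x = 0" "eval q x \<noteq> 0"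
  shows "no_common_factor p q"
  unfolding no_common_factor_def
proof (intro allI impI)
  fix g assume g: "g dvd p" "g dvd q"
  then obtain r where r: "p = g * r" by (auto simp: dvd_def)
  then consider "g dvd 1" | "r dvd 1" using assms(1) irreducibleD by blast
  then show "g dvd 1"
  proof cases
    case 2
    then have "p dvd g" using r by (metis dvd_triv_right mult.commute mult_dvd_mono mult_1 dvd_refl)
    then have "p dvd q" using g dvd_trans by blast
    then have "eval q x = 0" using assms(2) by (auto simp: dvd_def)
    then show ?thesis using assms(3) by simp
  qed
qed

section \<open>Zariski closures\<close>

lemma coords_point:
  assumes "x \<noteq> 0"
  obtains c where "c \<noteq> 0" "coords (point x) = c *s x"
  using point_eq_iff[OF assms coords_nonzero, of "point x"] by auto

lemma proj_cases:
  obtains x where "x \<noteq> 0" "p = point x"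
  using coords_nonzero point_coords by metis

lemma point_in_zero_locus:
  assumes "\<And>p. p \<in> S \<Longrightarrow> \<exists>d. homogeneous d p" "x \<noteq> 0"
  shows "point x \<in> zero_locus S \<longleftrightarrow> (\<forall>p\<in>S. eval p x = 0)"
proof -
  obtain c where c: "c \<noteq> 0" "coords (point x) = c *s x" using coords_point[OF assms(2)] .
  have "eval p (c *s x) = 0 \<longleftrightarrow> eval p x = 0" if "p \<in> S" for p
    using assms(1)[OF that] c(1) by (auto simp: eval_homogeneous_smult)
  then show ?thesis by (simp add: zero_locus_def c(2))
qed

lemma point_in_zero_locus_single:
  "homogeneous d p \<Longrightarrow> x \<noteq> 0 \<Longrightarrow> point x \<in> zero_locus {p} \<longleftrightarrow> eval p x = 0"
  using point_in_zero_locus[of "{p}" x] by auto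

lemma zariski_closed_zero_locus:
  "(\<And>p. p \<in> S \<Longrightarrow> \<exists>d. homogeneous d p) \<Longrightarrow> zariski_closed (zero_locus S)"
  unfolding zariski_closed_def by blast

lemma zariski_open_nonvanishing:
  assumes "finite F" and hom: "\<And>p. p \<in> F \<Longrightarrow> \<exists>d. homogeneous d p"
  shows "zariski_open {x. \<forall>p\<in>F. eval p (coords x) \<noteq> 0}"
proof -
  obtain d where "\<And>p. p \<in> F \<Longrightarrow> homogeneous (d p) p" using hom by metis
  then have "homogeneous (sum d F) (\<Prod>p\<in>F. p)" by (rule homogeneous_prod)
  moreover have "- {x. \<forall>p\<in>F. eval p (coords x) \<noteq> 0} = zero_locus {\<Prod>p\<in>F. p}"
    using assms(1) by (auto simp: zero_locus_def)
  ultimately show ?thesis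
    unfolding zariski_open_def zariski_closed_def by (metis singletonD)
qed

text \<open>Identities that hold where some polynomial does not vanish are extended to all arguments by
  restricting to a line and cancelling in the ring of univariate polynomials.\<close>

definition poly_fun :: "(complex \<Rightarrow> complex) \<Rightarrow> bool" where
  "poly_fun f \<longleftrightarrow> (\<exists>p. f = poly p)"

named_theorems poly_fun_intros

lemma poly_fun_const [poly_fun_intros]: "poly_fun (\<lambda>_. c)"
  unfolding poly_fun_def by (rule exI[of _ "[:c:]"]) auto

lemma poly_fun_ident [poly_fun_intros]: "poly_fun (\<lambda>z. z)"
  unfolding poly_fun_def by (rule exI[of _ "[:0, 1:]"]) auto

lemma poly_fun_add [poly_fun_intros]:
  "poly_fun f \<Longrightarrow> poly_fun g \<Longrightarrow> poly_fun (\<lambda>z. f z + g z)"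
  by (auto simp: poly_fun_def fun_eq_iff simp flip: poly_add)

lemma poly_fun_diff [poly_fun_intros]:
  "poly_fun f \<Longrightarrow> poly_fun g \<Longrightarrow> poly_fun (\<lambda>z. f z - g z)"
  by (auto simp: poly_fun_def fun_eq_iff simp flip: poly_diff)

lemma poly_fun_mult [poly_fun_intros]:
  "poly_fun f \<Longrightarrow> poly_fun g \<Longrightarrow> poly_fun (\<lambda>z. f z * g z)"
  by (auto simp: poly_fun_def fun_eq_iff simp flip: poly_mult)

lemma poly_fun_power [poly_fun_intros]: "poly_fun f \<Longrightarrow> poly_fun (\<lambda>z. f z ^ n)"
  by (induction n) (auto intro: poly_fun_intros)

lemma poly_fun_sum [poly_fun_intros]:
  "(\<And>i. i \<in> S \<Longrightarrow> poly_fun (f i)) \<Longrightarrow> poly_fun (\<lambda>z. \<Sum>i\<in>S. f i z)"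
  by (induction S rule: infinite_finite_induct) (auto intro: poly_fun_intros)

lemma poly_fun_prod [poly_fun_intros]:
  "(\<And>i. i \<in> S \<Longrightarrow> poly_fun (f i)) \<Longrightarrow> poly_fun (\<lambda>z. \<Prod>i\<in>S. f i z)"
  by (induction S rule: infinite_finite_induct) (auto intro: poly_fun_intros)

lemma poly_fun_eval [poly_fun_intros]:
  "(\<And>i. poly_fun (\<lambda>z. X z $ i)) \<Longrightarrow> poly_fun (\<lambda>z. eval p (X z))"
  unfolding eval_def by (intro poly_fun_intros)

lemma poly_fun_cancel:
  assumes "poly_fun f" "poly_fun g" "g a \<noteq> 0" "\<And>z. f z * g z = 0"
  shows "f z = 0"
proof -
  obtain p q where pq: "f = poly p" "g = poly q" using assms by (auto simp: poly_fun_def)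
  then have "poly (p * q) = poly 0" using assms(4) by (intro ext) auto
  then have "p * q = 0" by (simp only: poly_eq_poly_eq_iff)
  moreover have "q \<noteq> 0" using assms(3) pq by auto
  ultimately show ?thesis using pq by simp
qed

text \<open>This \<open>f\<close> is the shape of the faces of s and t in normal form. Its image
  reaches \<open>p *s a + q *s b + r *s v\<close> when \<open>c $ 0 * p + c $ 1 * q\<close> is
  nonzero. A form vanishing there vanishes on the whole plane, by polynomial continuation along
  lines of direction \<open>a\<close>.\<close>

lemma hull_punctured_plane:
  fixes a b v :: "complex^4" and c :: "complex^2"
  assumes L: "homogeneous 1 L"
    and plane: "\<And>x. eval L x = 0 \<longleftrightarrow> (\<exists>p q r. x = p *s a + q *s b + r *s v)"
    and "c $ 0 \<noteq> 0"
    and f: "\<And>t u. f t u = (u $ 0 + \<mu> * u $ 1) *s (t $ 0 *s a + t $ 1 *s b)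
      + (u $ 1 * (c $ 0 * t $ 0 + c $ 1 * t $ 1)) *s v"
  shows "zariski_closed hull {point (f t u) |(t :: complex^2) (u :: complex^2). f t u \<noteq> 0}
    = zero_locus {L}" (is "_ hull ?I = _")
proof (rule hull_unique)
  have hom: "\<exists>d. homogeneous d p" if "p \<in> {L}" for p using L that by blast
  show "zariski_closed (zero_locus {L})" by (intro zariski_closed_zero_locus hom)
  have "eval L (f t u) = 0" for t u
    unfolding plane f
    by (rule exI[of _ "(u $ 0 + \<mu> * u $ 1) * t $ 0"],
        rule exI[of _ "(u $ 0 + \<mu> * u $ 1) * t $ 1"],
        rule exI[of _ "u $ 1 * (c $ 0 * t $ 0 + c $ 1 * t $ 1)"])
      (simp add: vec_eq_iff algebra_simps)
  then show "?I \<subseteq> zero_locus {L}" by (auto simp: point_in_zero_locus_single[OF L])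
  fix V assume V: "?I \<subseteq> V" "zariski_closed V"
  then obtain S where S: "\<And>p. p \<in> S \<Longrightarrow> \<exists>d. homogeneous d p" "V = zero_locus S"
    unfolding zariski_closed_def by blast
  show "zero_locus {L} \<subseteq> V"
  proof
    fix P assume P: "P \<in> zero_locus {L}"
    obtain x where x: "x \<noteq> 0" "P = point x" using proj_cases .
    then have "eval L x = 0" using P by (simp add: point_in_zero_locus_single[OF L])
    then obtain p q r where pqr: "x = p *s a + q *s b + r *s v" using plane by auto
    \<comment> \<open>Since \<open>c $ 0\<close> is nonzero, moving in the direction
      \<open>a\<close> makes \<open>m\<close> a nonconstant polynomial, so the excluded values of z
      can be cancelled away.\<close>
    define X where "X = (\<lambda>z. (p + z) *s a + q *s b + r *s v)"
    define m where "m = (\<lambda>z. c $ 0 * (p + z) + c $ 1 * q)"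
    obtain l where l: "X 0 $ l \<noteq> 0" using x by (auto simp: X_def pqr vec_eq_iff)
    have X: "poly_fun (\<lambda>z. X z $ i)" for i
      unfolding X_def by (simp, intro poly_fun_intros)
    have m: "poly_fun m" unfolding m_def by (intro poly_fun_intros)
    have "eval g x = 0" if g: "g \<in> S" for g
    proof -
      have vanish: "eval g (X z) * m z * X z $ l = 0" for z
      proof (cases "m z = 0 \<or> X z $ l = 0")
        case False
        \<comment> \<open>This solves \<open>f t u = X z\<close>: the choice of \<open>u\<close>
          gives \<open>u $ 0 + \<mu> * u $ 1 = 1\<close> and \<open>u $ 1 * m z = r\<close>.\<close>
        define t :: "complex^2" where "t = (\<chi> i. if i = 0 then p + z else q)"
        define u :: "complex^2" where
          "u = (\<chi> i. if i = 0 then 1 - \<mu> * (r / m z) else r / m z)"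
        have "f t u = X z" using False by (simp add: f t_def u_def X_def m_def)
        moreover have "X z \<noteq> 0" using False by auto
        ultimately have "point (X z) \<in> V" using V(1) by (metis (mono_tags, lifting) mem_Collect_eq subsetD)
        then show ?thesis using S point_in_zero_locus[OF S(1) \<open>X z \<noteq> 0\<close>] g by auto
      qed auto
      have "eval g (X z) * m z = 0" for z
        by (rule poly_fun_cancel[OF _ X l vanish]) (intro poly_fun_intros X m)
      \<comment> \<open>At this argument \<open>m\<close> has the value 1.\<close>
      moreover have "m ((1 - c $ 1 * q) / c $ 0 - p) \<noteq> 0" using assms(3) by (simp add: m_def)
      ultimately have "eval g (X z) = 0" for z
        by (rule poly_fun_cancel[OF poly_fun_eval[OF X] m, rotated])
      from this[of 0] show ?thesis by (simp add: X_def pqr)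
    qed
    then show "P \<in> V" using S point_in_zero_locus[OF S(1) x(1)] x(2) by auto
  qed
qed

section \<open>Segre quadrics\<close>

lemma UNIV_2': "(UNIV :: 2 set) = {0, 1}"
  using UNIV_2 by auto

lemma sum_2': "sum f (UNIV :: 2 set) = f 0 + f 1"
  by (simp add: UNIV_2')

lemma all_2': "(\<forall>i :: 2. P i) \<longleftrightarrow> P 0 \<and> P 1"
  using UNIV_2' by (metis UNIV_I insertE singletonD)

lemma exhaust_2':
  fixes i :: 2
  obtains "i = 0" | "i = 1"
  using UNIV_2' by blast

text \<open>Indexing a basis of the 4-space by pairs makes the coordinates of a vector a 2 by 2
  matrix, whose determinant is the Segre form.\<close>

definition dual_basis :: "(2 \<Rightarrow> 2 \<Rightarrow> complex^4) \<Rightarrow> (2 \<Rightarrow> 2 \<Rightarrow> complex^4) \<Rightarrow> bool" where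
  "dual_basis e w \<longleftrightarrow>
     (\<forall>i j k l. lin (w i j) (e k l) = (if i = k \<and> j = l then 1 else 0)) \<and>
     (\<forall>x. x = (\<Sum>i\<in>UNIV. \<Sum>j\<in>UNIV. lin (w i j) x *s e i j))"

lemma dual_basis_lin:
  "dual_basis e w \<Longrightarrow> lin (w i j) (e k l) = (if i = k \<and> j = l then 1 else 0)"
  by (simp add: dual_basis_def)

lemma dual_basis_expand:
  "dual_basis e w \<Longrightarrow> x = (\<Sum>i\<in>UNIV. \<Sum>j\<in>UNIV. lin (w i j) x *s e i j)"
  unfolding dual_basis_def by blast

lemma dual_basis_eqI:
  assumes "dual_basis e w" "\<And>i j. lin (w i j) x = lin (w i j) y"
  shows "x = y"
  using dual_basis_expand[OF assms(1), of x] dual_basis_expand[OF assms(1), of y] assms(2) by simp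

definition segre :: "(2 \<Rightarrow> 2 \<Rightarrow> complex^4) \<Rightarrow> 4 mpoly" where
  "segre w = linform (w 0 0) * linform (w 1 1) - linform (w 0 1) * linform (w 1 0)"

lemma eval_segre:
  "eval (segre w) x = lin (w 0 0) x * lin (w 1 1) x - lin (w 0 1) x * lin (w 1 0) x"
  by (simp add: segre_def)

lemma homogeneous_segre: "homogeneous 2 (segre w)"
  unfolding segre_def using homogeneous_mult[OF homogeneous_linform homogeneous_linform]
  by (intro homogeneous_diff) (simp_all only: one_add_one)

lemma irreducible_segre:
  assumes "dual_basis e w"
  shows "irreducible (segre w)"
proof (rule homogeneous_2_irreducible[OF homogeneous_segre])
  note [simp] = dual_basis_lin[OF assms]
  have "eval (segre w) (e 0 0 + e 1 1) = 1" by (simp add: eval_segre)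
  then show "segre w \<noteq> 0" by auto
  fix v u
  show "\<not> (\<forall>x. eval (segre w) x = lin v x * lin u x)"
  proof
    assume "\<forall>x. eval (segre w) x = lin v x * lin u x"
    then have *: "lin v x * lin u x
        = lin (w 0 0) x * lin (w 1 1) x - lin (w 0 1) x * lin (w 1 0) x" for x
      by (simp add: eval_segre)
    \<comment> \<open>If \<open>v\<close> kills \<open>e 0 0\<close>, the value 1 at
      \<open>e 0 0 + e 1 1\<close> keeps \<open>u\<close> from killing it; the last two points then
      make \<open>v\<close> kill \<open>e 0 1\<close> and \<open>e 1 0\<close>, against the value -1
      at their sum. The case of \<open>u\<close> killing \<open>e 0 0\<close> is symmetric.\<close>
    show False
      using *[of "e 0 0"] *[of "e 0 1"] *[of "e 1 0"] *[of "e 1 1"] *[of "e 0 0 + e 1 1"]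
        *[of "e 0 1 + e 1 0"] *[of "e 0 0 + e 0 1"] *[of "e 0 0 + e 1 0"]
      by (auto simp: algebra_simps)
  qed
qed

text \<open>A nonzero corner gives the first column times the normalised first row; a zero corner
  forces the first row or the first column to vanish.\<close>

lemma rank_one_factors:
  fixes y :: "2 \<Rightarrow> 2 \<Rightarrow> complex"
  assumes "y 0 0 * y 1 1 = y 0 1 * y 1 0"
  obtains s t :: "complex^2" where "\<And>i j. y i j = s $ i * t $ j"
proof -
  have "\<exists>s t :: complex^2. \<forall>i j. y i j = s $ i * t $ j"
  proof (cases "y 0 0 = 0")
    case False
    then show ?thesis using assms
      by (intro exI[of _ "\<chi> i. y i 0"] exI[of _ "\<chi> j. y 0 j / y 0 0"])
        (simp add: all_2' field_simps)
  next
    case True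
    then consider "y 0 1 = 0" | "y 1 0 = 0" using assms by auto
    then show ?thesis
    proof cases
      case 1
      then show ?thesis using True
        by (intro exI[of _ "axis 1 1"] exI[of _ "\<chi> j. y 1 j"]) (simp add: all_2' axis_def)
    next
      case 2
      then show ?thesis using True
        by (intro exI[of _ "\<chi> i. y i 1"] exI[of _ "axis 1 1"]) (simp add: all_2' axis_def)
    qed
  qed
  then show thesis using that by blast
qed

lemma trilinear_Y:
  "trilinear \<phi> s t (axis k 1) = (\<Sum>i\<in>UNIV. \<Sum>j\<in>UNIV. (s $ i * t $ j) *s coeff_vec \<phi> i j k)"
  unfolding trilinear_def
  by (cases k rule: exhaust_2') (simp_all add: sum_2' axis_def)

text \<open>In the coordinates \<open>w\<close> the face sends (s, t) to the outer product of s and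
  t. These are all matrices of determinant zero, so the image is already closed.\<close>

lemma surf_Y_segre:
  assumes "dual_basis (\<lambda>i j. coeff_vec \<phi> i j k) w"
  shows "surf_Y \<phi> k = zero_locus {segre w}"
proof -
  note [simp] = dual_basis_lin[OF assms]
  have hom: "\<exists>d. homogeneous d p" if "p \<in> {segre w}" for p using homogeneous_segre that by blast
  have "{point (trilinear \<phi> s t (axis k 1)) |s t. trilinear \<phi> s t (axis k 1) \<noteq> 0}
      = zero_locus {segre w}" (is "?I = _")
  proof
    have "eval (segre w) (trilinear \<phi> s t (axis k 1)) = 0" for s t
      by (simp add: eval_segre trilinear_Y sum_2')
    then show "?I \<subseteq> zero_locus {segre w}" by (auto simp: point_in_zero_locus_single[OF homogeneous_segre])
    show "zero_locus {segre w} \<subseteq> ?I"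
    proof
      fix P assume P: "P \<in> zero_locus {segre w}"
      obtain x where x: "x \<noteq> 0" "P = point x" using proj_cases .
      then have "eval (segre w) x = 0" using P by (simp add: point_in_zero_locus_single[OF homogeneous_segre])
      then obtain s t :: "complex^2" where "\<And>i j. lin (w i j) x = s $ i * t $ j"
        using rank_one_factors[of "\<lambda>i j. lin (w i j) x"] by (auto simp: eval_segre)
      then have "x = trilinear \<phi> s t (axis k 1)"
        using dual_basis_expand[OF assms, of x] by (simp add: trilinear_Y)
      then show "P \<in> ?I" using x by auto
    qed
  qed
  then show ?thesis
    unfolding surf_Y_def by (simp only: hull_same[of zariski_closed, OF zariski_closed_zero_locus[OF hom]])
qed

lemma quadric_surface_segre:
  "dual_basis e w \<Longrightarrow> quadric_surface (zero_locus {segre w})"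
  unfolding quadric_surface_def using homogeneous_segre irreducible_segre by blast

text \<open>As \<open>c 0 0\<close> is nonzero, the coordinate of index (0, 0) can be eliminated on
  the plane. The remaining ternary form splits only if \<open>c\<close> has determinant zero, which
  is the case of a plane tangent to the quadric.\<close>

lemma plane_conic_segre:
  assumes dual: "dual_basis e w"
    and nz: "c 0 0 \<noteq> 0" "c 0 0 * c 1 1 \<noteq> c 0 1 * c 1 0"
  shows "plane_conic (zero_locus {linform (\<Sum>i\<in>UNIV. \<Sum>j\<in>UNIV. c i j *s w i j), segre w})"
proof -
  note [simp] = dual_basis_lin[OF dual]
  define l where "l = (\<Sum>i\<in>UNIV. \<Sum>j\<in>UNIV. c i j *s w i j)"
  have "eval (linform l) (e 0 0) \<noteq> eval 0 (e 0 0)" using nz by (simp add: l_def sum_2')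
  then have "linform l \<noteq> 0" by metis
  moreover have "\<not> linform l dvd segre w - a * b" if "homogeneous 1 a" "homogeneous 1 b" for a b
  proof
    assume "linform l dvd segre w - a * b"
    then obtain r where r: "segre w - a * b = linform l * r" by (auto simp: dvd_def)
    have zero: "eval (segre w) x = eval a x * eval b x" if "lin l x = 0" for x
    proof -
      have "eval (segre w - a * b) x = 0" by (simp only: r eval_mult eval_linform that mult_zero_left)
      then show ?thesis by simp
    qed
    obtain u v where uv: "\<And>x. eval a x = lin u x" "\<And>x. eval b x = lin v x"
      using \<open>homogeneous 1 a\<close> \<open>homogeneous 1 b\<close> homogeneous_1_eval by metis
    define q where "q = (\<lambda>i j. c i j / c 0 0)"
    \<comment> \<open>The vectors \<open>p 0 1\<close>, \<open>p 1 0\<close>, \<open>p 1 1\<close>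
      span the plane \<open>l\<close>, while \<open>p 0 0\<close> is zero.\<close>
    define p where "p = (\<lambda>i j. e i j - q i j *s e 0 0)"
    have "\<forall>i j. lin l (e i j) = c i j" by (simp add: l_def all_2' sum_2')
    then have p: "lin l (p i j) = 0" for i j
      using nz(1) by (simp add: p_def q_def)
    have *: "lin u x * lin v x
        = lin (w 0 0) x * lin (w 1 1) x - lin (w 0 1) x * lin (w 1 0) x" if "lin l x = 0" for x
      using zero[OF that] by (simp add: eval_segre uv)
    define a1 a2 a3 b1 b2 b3 where
      "a1 = lin u (p 0 1)" "a2 = lin u (p 1 0)" "a3 = lin u (p 1 1)"
      "b1 = lin v (p 0 1)" "b2 = lin v (p 1 0)" "b3 = lin v (p 1 1)"
    note ab = this
    have w: "lin (w i j) (p k l) = (if i = k \<and> j = l then 1 else 0)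
        - (if i = 0 \<and> j = 0 then q k l else 0)" for i j k l
      by (simp add: p_def)
    \<comment> \<open>Coefficients of \<open>a * b\<close> and of the restricted Segre form are
      compared: the squares first, the mixed terms in \<open>2\<close>.\<close>
    have 1: "a1 * b1 = 0" "a2 * b2 = 0" "a3 * b3 = - q 1 1"
      using *[of "p 0 1"] *[of "p 1 0"] *[of "p 1 1"] by (simp_all add: p ab w)
    have 2: "a1 * b2 + a2 * b1 = - 1" "a1 * b3 + a3 * b1 = - q 0 1" "a2 * b3 + a3 * b2 = - q 1 0"
      using *[of "p 0 1 + p 1 0"] *[of "p 0 1 + p 1 1"] *[of "p 1 0 + p 1 1"] 1
      by (simp_all add: p w algebra_simps eq_neg_iff_add_eq_0 flip: ab)
    \<comment> \<open>The products \<open>a1 * b1\<close> and \<open>a2 * b2\<close> vanish, so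
      exactly one of \<open>a1 * b2\<close> and \<open>a2 * b1\<close> survives and equals -1.
      Regrouping the four factors of \<open>q 0 1 * q 1 0\<close> then gives
      \<open>q 1 1\<close>.\<close>
    have "q 1 1 = q 0 1 * q 1 0"
    proof (cases "a1 = 0")
      case True
      then have "b2 = 0" using 1 2 by auto
      then have "q 0 1 * q 1 0 = (a3 * b1) * (a2 * b3)" using 2 True by simp
      also have "\<dots> = (a3 * b3) * (a2 * b1)" by (simp only: mult_ac)
      finally show ?thesis using 1 2 True by simp
    next
      case False
      then have "b1 = 0" using 1 by auto
      then have "b2 \<noteq> 0" using 2 by auto
      then have "a2 = 0" using 1 by auto
      then have "q 0 1 * q 1 0 = (a1 * b3) * (a3 * b2)" using 2 \<open>b1 = 0\<close> by simp
      also have "\<dots> = (a3 * b3) * (a1 * b2)" by (simp only: mult_ac)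
      finally show ?thesis using 1 2 \<open>b1 = 0\<close> by simp
    qed
    then show False using nz by (simp add: q_def field_simps)
  qed
  ultimately show ?thesis
    unfolding plane_conic_def l_def[symmetric]
    using homogeneous_linform homogeneous_segre by blast
qed

section \<open>The normal form\<close>

lemma point_smult: "c *s x \<noteq> 0 \<Longrightarrow> point (c *s x) = point x"
proof -
  assume nz: "c *s x \<noteq> 0"
  then have "c \<noteq> 0" "x \<noteq> 0" by auto
  then show ?thesis using point_eq_iff[of x "c *s x"] nz by auto
qed

lemma point_in_join:
  assumes "x \<noteq> 0" "a \<noteq> 0" "b \<noteq> 0"
  shows "point x \<in> join (point a) (point b) \<longleftrightarrow> (\<exists>p q. x = p *s a + q *s b)"
proof -
  obtain c where c: "c \<noteq> 0" "coords (point a) = c *s a" using coords_point[OF assms(2)] .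
  obtain d where d: "d \<noteq> 0" "coords (point b) = d *s b" using coords_point[OF assms(3)] .
  show ?thesis
  proof
    assume "point x \<in> join (point a) (point b)"
    then obtain p q where pq: "point x = point (p *s coords (point a) + q *s coords (point b))"
      "p *s coords (point a) + q *s coords (point b) \<noteq> 0"
      unfolding join_def by blast
    then obtain m where "m \<noteq> 0" "x = m *s (p *s coords (point a) + q *s coords (point b))"
      using point_eq_iff[OF pq(2) assms(1)] by metis
    then have "x = (m * p * c) *s a + (m * q * d) *s b"
      by (simp add: c d vec_eq_iff algebra_simps)
    then show "\<exists>p q. x = p *s a + q *s b" by blast
  next
    assume "\<exists>p q. x = p *s a + q *s b"
    then obtain p q where "x = p *s a + q *s b" by blast
    then have "x = (p / c) *s coords (point a) + (q / d) *s coords (point b)"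
      using c d by (simp add: vec_eq_iff)
    then show "point x \<in> join (point a) (point b)" unfolding join_def using assms(1) by blast
  qed
qed

text \<open>This rank-one matrix is annihilated by \<open>g\<close> on the right and by
  \<open>h\<close> on the left, which places the apex on the axes of both pencils.\<close>

definition apex_coeff :: "(2 \<Rightarrow> complex) \<Rightarrow> (2 \<Rightarrow> complex) \<Rightarrow> 2 \<Rightarrow> 2 \<Rightarrow> complex" where
  "apex_coeff g h i j = (if i = 0 then h 1 else - h 0) * (if j = 0 then g 1 else - g 0)"

text \<open>The passage from the vectors with k = 0 to those with k = 1 is \<mu> times the identity
  plus a rank-one map onto the apex. Its determinant is the cube of \<mu> times the sum in
  \<open>\<kappa>\<close>, so the last two assumptions say that it is invertible. The condition
  \<open>det_c\<close> keeps the plane \<open>\<sigma>\<close> from being tangent to the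
  quadric.\<close>

locale normal_form =
  fixes \<phi> :: trilinear_map and w :: "2 \<Rightarrow> 2 \<Rightarrow> complex^4"
    and c :: "2 \<Rightarrow> 2 \<Rightarrow> complex" and g h :: "2 \<Rightarrow> complex" and \<mu> :: complex
  assumes dual: "dual_basis (\<lambda>i j. coeff_vec \<phi> i j 0) w"
    and upper: "\<And>i j. coeff_vec \<phi> i j 1 = \<mu> *s coeff_vec \<phi> i j 0
      + c i j *s (\<Sum>k\<in>UNIV. \<Sum>l\<in>UNIV. apex_coeff g h k l *s coeff_vec \<phi> k l 0)"
    and g: "\<And>i. g i \<noteq> 0" and h: "\<And>i. h i \<noteq> 0" and c: "\<And>i j. c i j \<noteq> 0"
    and det_c: "c 0 0 * c 1 1 \<noteq> c 0 1 * c 1 0"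
    and \<mu>: "\<mu> \<noteq> 0"
    and \<kappa>: "\<mu> + (\<Sum>i\<in>UNIV. \<Sum>j\<in>UNIV. c i j * apex_coeff g h i j) \<noteq> 0"
begin

abbreviation "e i j \<equiv> coeff_vec \<phi> i j 0"
abbreviation "y i j x \<equiv> lin (w i j) x"

definition "\<kappa>0 = (\<Sum>i\<in>UNIV. \<Sum>j\<in>UNIV. c i j * apex_coeff g h i j)"
definition "apex = (\<Sum>k\<in>UNIV. \<Sum>l\<in>UNIV. apex_coeff g h k l *s e k l)"
definition "\<alpha> i = g 0 *s w i 0 + g 1 *s w i 1"
definition "\<beta> j = h 0 *s w 0 j + h 1 *s w 1 j"
definition "\<tau> = h 0 *s \<alpha> 0 + h 1 *s \<alpha> 1"
definition "\<sigma> = (\<Sum>i\<in>UNIV. \<Sum>j\<in>UNIV. c i j *s w i j)"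

lemma y_e [simp]: "y i j (e k l) = (if i = k \<and> j = l then 1 else 0)"
  using dual_basis_lin[OF dual] by simp

lemma e_nonzero [simp]: "e i j \<noteq> 0"
  using y_e[of i j i j] by (metis lin_0 zero_neq_one)

lemma y_apex [simp]: "y i j apex = apex_coeff g h i j"
proof -
  have "\<forall>i j. y i j apex = apex_coeff g h i j" by (simp add: apex_def sum_2' all_2')
  then show ?thesis by blast
qed

lemma apex_nonzero: "apex \<noteq> 0"
proof
  assume "apex = 0"
  then have "apex_coeff g h 0 0 = 0" using y_apex[of 0 0] by simp
  then show False using g[of 1] h[of 1] by (simp add: apex_coeff_def)
qed

lemma upper': "coeff_vec \<phi> i j 1 = \<mu> *s e i j + c i j *s apex"
  using upper by (simp add: apex_def)

lemmas eqI = dual_basis_eqI[OF dual]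

definition "cst s t = (\<Sum>k\<in>UNIV. \<Sum>l\<in>UNIV. c k l * (s :: complex^2) $ k * (t :: complex^2) $ l)"

text \<open>By \<open>upper'\<close>, varying u rescales the outer product of s and t and adds a
  multiple of the apex; the formulas for the inverse are all read off from this.\<close>

lemma y_trilinear:
  "y i j (trilinear \<phi> s t u) = (u $ 0 + \<mu> * u $ 1) * (s $ i * t $ j)
    + u $ 1 * cst s t * apex_coeff g h i j"
proof -
  have "trilinear \<phi> s t u
      = (\<Sum>i\<in>UNIV. \<Sum>j\<in>UNIV. ((u $ 0 + \<mu> * u $ 1) * (s $ i * t $ j)) *s e i j)
        + (u $ 1 * cst s t) *s apex"
    by (simp add: trilinear_def cst_def sum_2' upper' vec_eq_iff algebra_simps)
  then have "\<forall>i j. y i j (trilinear \<phi> s t u) = (u $ 0 + \<mu> * u $ 1) * (s $ i * t $ j)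
      + u $ 1 * cst s t * apex_coeff g h i j"
    by (simp add: sum_2' all_2')
  then show ?thesis by blast
qed

section \<open>The boundary planes \<open>\<Sigma>\<^sub>i\<close> and
  \<open>T\<^sub>j\<close>\<close>

lemma plane_S:
  assumes "i \<noteq> i'"
  shows "lin (\<alpha> i') x = 0 \<longleftrightarrow> (\<exists>p q r. x = p *s e i 0 + q *s e i 1 + r *s apex)"
proof
  assume "\<exists>p q r. x = p *s e i 0 + q *s e i 1 + r *s apex"
  then show "lin (\<alpha> i') x = 0"
    using assms by (auto simp: \<alpha>_def apex_coeff_def)
next
  assume 0: "lin (\<alpha> i') x = 0"
  \<comment> \<open>Row \<open>i\<close> of the coordinate matrix is unconstrained. Row
    \<open>i'\<close> is orthogonal to \<open>g\<close>, hence a multiple of the same row of the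
    apex, and \<open>r\<close> is the factor.\<close>
  define r where "r = y i' 1 x / apex_coeff g h i' 1"
  have nz: "apex_coeff g h k l \<noteq> 0" for k l using g h by (simp add: apex_coeff_def)
  have r1: "y i' 1 x = r * apex_coeff g h i' 1" using nz by (simp add: r_def)
  have r0: "y i' 0 x = r * apex_coeff g h i' 0"
  proof -
    have "g 0 * y i' 0 x = - (g 1 * y i' 1 x)" using 0 by (simp add: \<alpha>_def eq_neg_iff_add_eq_0)
    also have "\<dots> = g 0 * (r * apex_coeff g h i' 0)"
      by (subst r1) (simp add: apex_coeff_def)
    finally show ?thesis using g by simp
  qed
  have "x = (y i 0 x - r * apex_coeff g h i 0) *s e i 0
      + (y i 1 x - r * apex_coeff g h i 1) *s e i 1 + r *s apex"
  proof (rule eqI)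
    fix k l
    have "k = i \<or> k = i'" using assms UNIV_2' by (metis UNIV_I insertE singletonD)
    then show "y k l x = y k l ((y i 0 x - r * apex_coeff g h i 0) *s e i 0
        + (y i 1 x - r * apex_coeff g h i 1) *s e i 1 + r *s apex)"
      using assms r0 r1 by (cases l rule: exhaust_2') auto
  qed
  then show "\<exists>p q r. x = p *s e i 0 + q *s e i 1 + r *s apex" by blast
qed

lemma plane_T:
  assumes "j \<noteq> j'"
  shows "lin (\<beta> j') x = 0 \<longleftrightarrow> (\<exists>p q r. x = p *s e 0 j + q *s e 1 j + r *s apex)"
proof
  assume "\<exists>p q r. x = p *s e 0 j + q *s e 1 j + r *s apex"
  then show "lin (\<beta> j') x = 0"
    using assms by (auto simp: \<beta>_def apex_coeff_def)
next
  assume 0: "lin (\<beta> j') x = 0"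
  define r where "r = y 1 j' x / apex_coeff g h 1 j'"
  have nz: "apex_coeff g h k l \<noteq> 0" for k l using g h by (simp add: apex_coeff_def)
  have r1: "y 1 j' x = r * apex_coeff g h 1 j'" using nz by (simp add: r_def)
  have r0: "y 0 j' x = r * apex_coeff g h 0 j'"
  proof -
    have "h 0 * y 0 j' x = - (h 1 * y 1 j' x)" using 0 by (simp add: \<beta>_def eq_neg_iff_add_eq_0)
    also have "\<dots> = h 0 * (r * apex_coeff g h 0 j')"
      by (subst r1) (simp add: apex_coeff_def)
    finally show ?thesis using h by simp
  qed
  have "x = (y 0 j x - r * apex_coeff g h 0 j) *s e 0 j
      + (y 1 j x - r * apex_coeff g h 1 j) *s e 1 j + r *s apex"
  proof (rule eqI)
    fix k l
    have "l = j \<or> l = j'" using assms UNIV_2' by (metis UNIV_I insertE singletonD)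
    then show "y k l x = y k l ((y 0 j x - r * apex_coeff g h 0 j) *s e 0 j
        + (y 1 j x - r * apex_coeff g h 1 j) *s e 1 j + r *s apex)"
      using assms r0 r1 by (cases k rule: exhaust_2') auto
  qed
  then show "\<exists>p q r. x = p *s e 0 j + q *s e 1 j + r *s apex" by blast
qed

text \<open>The index changes because \<open>\<alpha> i'\<close> is a multiple of
  \<open>s $ i'\<close> on the image, and this vanishes on the face of index
  \<open>i\<close>.\<close>

lemma surf_S_eq:
  assumes "i \<noteq> i'"
  shows "surf_S \<phi> i = zero_locus {linform (\<alpha> i')}"
  unfolding surf_S_def
proof (rule hull_punctured_plane[OF homogeneous_linform])
  show "eval (linform (\<alpha> i')) x = 0 \<longleftrightarrow> (\<exists>p q r. x = p *s e i 0 + q *s e i 1 + r *s apex)" for x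
    using plane_S[OF assms] by simp
  show "(\<chi> j. c i j) $ 0 \<noteq> 0" using c by simp
  show "trilinear \<phi> (axis i 1) t u = (u $ 0 + \<mu> * u $ 1) *s (t $ 0 *s e i 0 + t $ 1 *s e i 1)
      + (u $ 1 * ((\<chi> j. c i j) $ 0 * t $ 0 + (\<chi> j. c i j) $ 1 * t $ 1)) *s apex" for t u
    unfolding trilinear_def
    by (cases i rule: exhaust_2')
      (simp_all add: sum_2' axis_def upper' vec_eq_iff algebra_simps)
qed

lemma surf_T_eq:
  assumes "j \<noteq> j'"
  shows "surf_T \<phi> j = zero_locus {linform (\<beta> j')}"
  unfolding surf_T_def
proof (rule hull_punctured_plane[OF homogeneous_linform])
  show "eval (linform (\<beta> j')) x = 0 \<longleftrightarrow> (\<exists>p q r. x = p *s e 0 j + q *s e 1 j + r *s apex)" for x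
    using plane_T[OF assms] by simp
  show "(\<chi> i. c i j) $ 0 \<noteq> 0" using c by simp
  show "trilinear \<phi> s (axis j 1) u = (u $ 0 + \<mu> * u $ 1) *s (s $ 0 *s e 0 j + s $ 1 *s e 1 j)
      + (u $ 1 * ((\<chi> i. c i j) $ 0 * s $ 0 + (\<chi> i. c i j) $ 1 * s $ 1)) *s apex" for s u
    unfolding trilinear_def
    by (cases j rule: exhaust_2')
      (simp_all add: sum_2' axis_def upper' vec_eq_iff algebra_simps)
qed


section \<open>The second quadric \<open>Y\<^sub>1\<close>\<close>

definition "w' i j = inverse \<mu> *s w i j - (apex_coeff g h i j / ((\<mu> + \<kappa>0) * \<mu>)) *s \<sigma>"

lemma \<kappa>0: "\<mu> + \<kappa>0 \<noteq> 0"
  using \<kappa> by (simp add: \<kappa>0_def)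

lemma y_upper: "y k l (coeff_vec \<phi> i j 1)
    = (if k = i \<and> l = j then \<mu> else 0) + c i j * apex_coeff g h k l"
  by (simp add: upper')

lemma \<sigma>_lin: "lin \<sigma> x = (\<Sum>i\<in>UNIV. \<Sum>j\<in>UNIV. c i j * y i j x)"
  by (simp add: \<sigma>_def)

lemma \<sigma>_upper: "lin \<sigma> (coeff_vec \<phi> i j 1) = c i j * (\<mu> + \<kappa>0)"
proof -
  have "\<forall>i j. lin \<sigma> (coeff_vec \<phi> i j 1) = c i j * (\<mu> + \<kappa>0)"
    by (simp add: \<sigma>_lin y_upper sum_2' all_2' \<kappa>0_def algebra_simps)
  then show ?thesis by blast
qed

text \<open>The functionals \<open>w'\<close> come from the Sherman-Morrison formula for the inverse
  of \<mu> times the identity plus a rank-one map.\<close>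

lemma dual_upper: "dual_basis (\<lambda>i j. coeff_vec \<phi> i j 1) w'"
  unfolding dual_basis_def
proof (intro conjI allI)
  show "lin (w' i j) (coeff_vec \<phi> k l 1) = (if i = k \<and> j = l then 1 else 0)" for i j k l
  proof -
    define K where "K = \<mu> + \<kappa>0"
    have "K \<noteq> 0" using \<kappa>0 by (simp add: K_def)
    then show ?thesis
      using \<mu> by (simp add: w'_def y_upper \<sigma>_upper K_def[symmetric] field_simps)
  qed
  fix x
  show "x = (\<Sum>i\<in>UNIV. \<Sum>j\<in>UNIV. lin (w' i j) x *s coeff_vec \<phi> i j 1)"
  proof (rule eqI)
    fix k l
    \<comment> \<open>By \<open>\<sigma>_upper\<close>, this must be the sum of the new coordinates
      of \<open>x\<close> weighted with \<open>c\<close>; the fact \<open>*\<close> confirms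
      it.\<close>
    define s where "s = lin \<sigma> x / (\<mu> + \<kappa>0)"
    have w': "lin (w' i j) x = (y i j x - apex_coeff g h i j * s) / \<mu>" for i j
    proof -
      define K where "K = \<mu> + \<kappa>0"
      have "K \<noteq> 0" using \<kappa>0 by (simp add: K_def)
      then show ?thesis using \<mu> by (simp add: w'_def s_def K_def[symmetric] field_simps)
    qed
    have *: "(\<Sum>i\<in>UNIV. \<Sum>j\<in>UNIV. lin (w' i j) x * c i j) = s"
    proof -
      have "(\<Sum>i\<in>UNIV. \<Sum>j\<in>UNIV. lin (w' i j) x * c i j) = (lin \<sigma> x - \<kappa>0 * s) / \<mu>"
        by (simp add: w' \<sigma>_lin \<kappa>0_def sum_2' diff_divide_distrib add_divide_distrib algebra_simps)
      also have "lin \<sigma> x = (\<mu> + \<kappa>0) * s" using \<kappa>0 by (simp add: s_def)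
      finally show ?thesis using \<mu> by (simp add: algebra_simps)
    qed
    have "y k l (\<Sum>i\<in>UNIV. \<Sum>j\<in>UNIV. lin (w' i j) x *s coeff_vec \<phi> i j 1)
      = (\<Sum>i\<in>UNIV. \<Sum>j\<in>UNIV. (if k = i \<and> l = j then lin (w' i j) x * \<mu> else 0)
          + (lin (w' i j) x * c i j) * apex_coeff g h k l)"
      unfolding lin_sum lin_smult y_upper by (intro sum.cong refl) (simp add: algebra_simps)
    also have "\<dots> = (\<Sum>i\<in>UNIV. \<Sum>j\<in>UNIV. (if k = i \<and> l = j then lin (w' i j) x * \<mu> else 0))
      + s * apex_coeff g h k l"
      by (simp only: sum.distrib * flip: sum_distrib_right)
    also have "(\<Sum>i\<in>UNIV. \<Sum>j\<in>UNIV. (if k = i \<and> l = j then lin (w' i j) x * \<mu> else 0))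
      = lin (w' k l) x * \<mu>"
      by (cases k rule: exhaust_2'; cases l rule: exhaust_2') (simp_all add: sum_2')
    finally have eq: "y k l (\<Sum>i\<in>UNIV. \<Sum>j\<in>UNIV. lin (w' i j) x *s coeff_vec \<phi> i j 1)
      = s * apex_coeff g h k l + lin (w' k l) x * \<mu>" by (simp only: add.commute)
    show "y k l x = y k l (\<Sum>i\<in>UNIV. \<Sum>j\<in>UNIV. lin (w' i j) x *s coeff_vec \<phi> i j 1)"
      unfolding eq using \<mu> by (simp add: w')
  qed
qed

section \<open>The pencil of quadrics and its base locus\<close>

lemma \<tau>_lin: "lin \<tau> x = h 0 * lin (\<alpha> 0) x + h 1 * lin (\<alpha> 1) x"
  by (simp add: \<tau>_def)

text \<open>The quadrics of the pencil are the linear combinations of \<open>segre w\<close> and \<open>\<sigma> * \<tau>\<close>, where the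
  plane \<open>\<tau> = 0\<close> is tangent to all of them at the apex.\<close>

lemma segre_upper:
  "(\<mu> + \<kappa>0) * \<mu>\<^sup>2 * eval (segre w') x = (\<mu> + \<kappa>0) * eval (segre w) x - lin \<sigma> x * lin \<tau> x"
proof -
  define k where "k = \<mu> + \<kappa>0"
  have k: "k \<noteq> 0" using \<kappa>0 by (simp add: k_def)
  have w': "lin (w' i j) x = (k * y i j x - apex_coeff g h i j * lin \<sigma> x) / (k * \<mu>)" for i j
    using \<mu> k by (simp add: w'_def k_def[symmetric] field_simps)
  \<comment> \<open>The determinant is expanded. The term quadratic in \<sigma> drops out because
    the apex matrix has rank one, and the mixed term is the product of \<sigma> and \<tau>.\<close>
  have "k * (k * \<mu>\<^sup>2 * eval (segre w') x)
      = (k * y 0 0 x - apex_coeff g h 0 0 * lin \<sigma> x) * (k * y 1 1 x - apex_coeff g h 1 1 * lin \<sigma> x)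
      - (k * y 0 1 x - apex_coeff g h 0 1 * lin \<sigma> x) * (k * y 1 0 x - apex_coeff g h 1 0 * lin \<sigma> x)"
    using \<mu> k by (simp add: eval_segre w' field_simps power2_eq_square)
  also have "\<dots> = k * (k * eval (segre w) x - lin \<sigma> x * lin \<tau> x)"
    by (simp add: eval_segre apex_coeff_def \<tau>_def \<alpha>_def algebra_simps)
  finally show ?thesis using k by (simp add: k_def)
qed

text \<open>For 2 by 2 matrices, \<open>y g h y\<close> is \<open>h y g\<close> times
  \<open>y\<close> minus \<open>det y\<close> times the apex matrix. Both the base locus and the
  inverse rest on this identity.\<close>

lemma \<alpha>\<beta>:
  "lin (\<alpha> i) x * lin (\<beta> j) x = y i j x * lin \<tau> x - eval (segre w) x * apex_coeff g h i j"
proof -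
  have "\<forall>i j. lin (\<alpha> i) x * lin (\<beta> j) x
      = y i j x * lin \<tau> x - eval (segre w) x * apex_coeff g h i j"
    by (simp add: all_2' eval_segre apex_coeff_def \<tau>_def \<alpha>_def \<beta>_def algebra_simps)
  then show ?thesis by blast
qed

lemma \<tau>_eq: "lin \<tau> x = g 0 * lin (\<beta> 0) x + g 1 * lin (\<beta> 1) x"
  by (simp add: \<tau>_def \<alpha>_def \<beta>_def algebra_simps)

text \<open>On the quadric and the plane \<tau> all products of an \<alpha> with a \<beta> vanish by
  \<open>\<alpha>\<beta>\<close>, so one family vanishes entirely. Conversely \<tau> is a
  combination of either family. The two lines are those in which the tangent plane at the apex cuts
  the quadric.\<close>

lemma base_locus:
  "eval (segre w) x = 0 \<and> lin \<tau> x = 0 \<longleftrightarrow> (\<forall>i. lin (\<alpha> i) x = 0) \<or> (\<forall>j. lin (\<beta> j) x = 0)"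
proof
  assume "eval (segre w) x = 0 \<and> lin \<tau> x = 0"
  then have "lin (\<alpha> i) x * lin (\<beta> j) x = 0" for i j using \<alpha>\<beta> by simp
  then show "(\<forall>i. lin (\<alpha> i) x = 0) \<or> (\<forall>j. lin (\<beta> j) x = 0)" by (metis mult_eq_0_iff)
next
  assume *: "(\<forall>i. lin (\<alpha> i) x = 0) \<or> (\<forall>j. lin (\<beta> j) x = 0)"
  then have \<tau>: "lin \<tau> x = 0" using \<tau>_lin[of x] \<tau>_eq[of x] by auto
  have "lin (\<alpha> 0) x * lin (\<beta> 0) x = 0" using * by auto
  then have "eval (segre w) x * apex_coeff g h 0 0 = 0" using \<alpha>\<beta>[of 0 x 0] \<tau> by simp
  then show "eval (segre w) x = 0 \<and> lin \<tau> x = 0" using \<tau> g h by (simp add: apex_coeff_def)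
qed

lemma in_intersection:
  assumes "x \<noteq> 0"
  shows "point x \<in> surf_Y \<phi> 0 \<inter> surf_Y \<phi> 1 \<longleftrightarrow> eval (segre w) x = 0 \<and> lin \<sigma> x * lin \<tau> x = 0"
  using segre_upper[of x] \<kappa>0 \<mu>
  by (auto simp: surf_Y_segre[OF dual] surf_Y_segre[OF dual_upper] assms
      point_in_zero_locus_single[OF homogeneous_segre])

definition "res_conic = zero_locus {linform \<sigma>, segre w}"

lemma in_conic:
  assumes "x \<noteq> 0"
  shows "point x \<in> res_conic \<longleftrightarrow> lin \<sigma> x = 0 \<and> eval (segre w) x = 0"
  unfolding res_conic_def using homogeneous_linform[of \<sigma>] homogeneous_segre[of w]
  by (subst point_in_zero_locus) (auto simp: assms)

lemma in_line_s:
  "x \<noteq> 0 \<Longrightarrow> point x \<in> surf_S \<phi> 0 \<inter> surf_S \<phi> 1 \<longleftrightarrow> (\<forall>i. lin (\<alpha> i) x = 0)"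
  by (auto simp: surf_S_eq[of 0 1] surf_S_eq[of 1 0] all_2'
      point_in_zero_locus_single[OF homogeneous_linform])

lemma in_line_t:
  "x \<noteq> 0 \<Longrightarrow> point x \<in> surf_T \<phi> 0 \<inter> surf_T \<phi> 1 \<longleftrightarrow> (\<forall>j. lin (\<beta> j) x = 0)"
  by (auto simp: surf_T_eq[of 0 1] surf_T_eq[of 1 0] all_2'
      point_in_zero_locus_single[OF homogeneous_linform])

lemma plane_conic_conic: "plane_conic res_conic"
  unfolding res_conic_def \<sigma>_def by (rule plane_conic_segre[of "\<lambda>i j. e i j"]) (use dual c det_c in auto)

lemma intersection_eq:
  "surf_Y \<phi> 0 \<inter> surf_Y \<phi> 1
    = (surf_S \<phi> 0 \<inter> surf_S \<phi> 1) \<union> (surf_T \<phi> 0 \<inter> surf_T \<phi> 1) \<union> res_conic"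
proof (rule set_eqI)
  fix P :: "4 proj"
  obtain x where x: "x \<noteq> 0" "P = point x" using proj_cases .
  show "P \<in> surf_Y \<phi> 0 \<inter> surf_Y \<phi> 1 \<longleftrightarrow>
      P \<in> (surf_S \<phi> 0 \<inter> surf_S \<phi> 1) \<union> (surf_T \<phi> 0 \<inter> surf_T \<phi> 1) \<union> res_conic"
    unfolding x(2) Un_iff in_intersection[OF x(1)] in_line_s[OF x(1)] in_line_t[OF x(1)]
      in_conic[OF x(1)] base_locus[symmetric] by auto
qed

lemma conic_meets_s: "res_conic \<inter> (surf_S \<phi> 0 \<inter> surf_S \<phi> 1) \<noteq> {}"
proof -
  \<comment> \<open>Points of this axis have coordinates \<open>a i * g 1\<close> and
    \<open>- a i * g 0\<close> in row \<open>i\<close>. The chosen \<open>a\<close> solves the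
    equation of \<sigma>; it is zero only if \<open>c\<close> kills the vector with entries
    \<open>g 1\<close> and \<open>- g 0\<close>.\<close>
  define a where "a = (\<lambda>i :: 2. if i = 0 then c 1 0 * g 1 - c 1 1 * g 0 else c 0 1 * g 0 - c 0 0 * g 1)"
  define x where "x = (\<Sum>i\<in>UNIV. (a i * g 1) *s e i 0 - (a i * g 0) *s e i 1)"
  have y: "y 0 0 x = a 0 * g 1" "y 0 1 x = - a 0 * g 0" "y 1 0 x = a 1 * g 1" "y 1 1 x = - a 1 * g 0"
    by (simp_all add: x_def sum_2')
  have "x \<noteq> 0"
  proof
    assume "x = 0"
    then have "a 0 = 0" "a 1 = 0" using y g by auto
    then have "c 1 0 * g 1 = c 1 1 * g 0" "c 0 1 * g 0 = c 0 0 * g 1" by (simp_all add: a_def)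
    then have "(c 0 0 * c 1 1) * (g 0 * g 1) = (c 0 1 * c 1 0) * (g 0 * g 1)"
      by (metis mult.assoc mult.commute)
    then show False using det_c g by simp
  qed
  moreover have "\<forall>i. lin (\<alpha> i) x = 0" using y by (simp add: \<alpha>_def all_2')
  moreover have "lin \<sigma> x = 0"
    unfolding \<sigma>_lin sum_2' y by (simp add: a_def algebra_simps)
  ultimately have "point x \<in> res_conic \<inter> (surf_S \<phi> 0 \<inter> surf_S \<phi> 1)"
    using in_conic in_line_s base_locus by blast
  then show ?thesis by blast
qed

lemma conic_meets_t: "res_conic \<inter> (surf_T \<phi> 0 \<inter> surf_T \<phi> 1) \<noteq> {}"
proof -
  \<comment> \<open>Rows and columns are exchanged: column \<open>j\<close> has the entries
    \<open>a j * h 1\<close> and \<open>- a j * h 0\<close>.\<close>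
  define a where "a = (\<lambda>j :: 2. if j = 0 then c 0 1 * h 1 - c 1 1 * h 0 else c 1 0 * h 0 - c 0 0 * h 1)"
  define x where "x = (\<Sum>j\<in>UNIV. (a j * h 1) *s e 0 j - (a j * h 0) *s e 1 j)"
  have y: "y 0 0 x = a 0 * h 1" "y 1 0 x = - a 0 * h 0" "y 0 1 x = a 1 * h 1" "y 1 1 x = - a 1 * h 0"
    by (simp_all add: x_def sum_2')
  have "x \<noteq> 0"
  proof
    assume "x = 0"
    then have "a 0 = 0" "a 1 = 0" using y h by auto
    then have "c 0 1 * h 1 = c 1 1 * h 0" "c 1 0 * h 0 = c 0 0 * h 1" by (simp_all add: a_def)
    then have "(c 0 0 * c 1 1) * (h 0 * h 1) = (c 0 1 * c 1 0) * (h 0 * h 1)"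
      by (metis mult.assoc mult.commute)
    then show False using det_c h by simp
  qed
  moreover have "\<forall>j. lin (\<beta> j) x = 0" using y by (simp add: \<beta>_def all_2')
  moreover have "lin \<sigma> x = 0"
    unfolding \<sigma>_lin sum_2' y by (simp add: a_def algebra_simps)
  ultimately have "point x \<in> res_conic \<inter> (surf_T \<phi> 0 \<inter> surf_T \<phi> 1)"
    using in_conic in_line_t base_locus by blast
  then show ?thesis by blast
qed

section \<open>The boundary lines of u through the apex\<close>

lemma in_line_u:
  assumes "x \<noteq> 0"
  shows "point x \<in> line_u \<phi> i j \<longleftrightarrow> (\<exists>p q. x = p *s e i j + q *s apex)"
proof -
  have "coeff_vec \<phi> i j 1 \<noteq> 0"
    using dual_basis_lin[OF dual_upper, of i j i j] by (metis lin_0 zero_neq_one)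
  then have "point x \<in> line_u \<phi> i j \<longleftrightarrow> (\<exists>p q. x = p *s e i j + q *s coeff_vec \<phi> i j 1)"
    unfolding line_u_def control_point_def by (intro point_in_join assms e_nonzero)
  also have "\<dots> \<longleftrightarrow> (\<exists>p q. x = p *s e i j + q *s apex)"
  proof safe
    fix p q
    have "p *s e i j + q *s coeff_vec \<phi> i j 1 = (p + q * \<mu>) *s e i j + (q * c i j) *s apex"
      by (simp add: upper' vec_eq_iff algebra_simps)
    then show "\<exists>p' q'. p *s e i j + q *s coeff_vec \<phi> i j 1 = p' *s e i j + q' *s apex" by blast
    have "p *s e i j + q *s apex = (p - q * \<mu> / c i j) *s e i j + (q / c i j) *s coeff_vec \<phi> i j 1"
      using c by (simp add: upper' vec_eq_iff field_simps)
    then show "\<exists>p' q'. p *s e i j + q *s apex = p' *s e i j + q' *s coeff_vec \<phi> i j 1" by blast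
  qed
  finally show ?thesis .
qed

text \<open>Two opposite lines already meet only in the apex: neither \<open>e 0 0\<close> nor
  \<open>e 1 1\<close> contributes to the coordinate of index (0, 1), so the coefficients of the
  apex agree.\<close>

lemma lines_u_meet: "(\<Inter>i. \<Inter>j. line_u \<phi> i j) = {point apex}"
proof (rule set_eqI)
  fix P :: "4 proj"
  obtain x where x: "x \<noteq> 0" "P = point x" using proj_cases .
  have "x = d *s apex" if "x = p *s e 0 0 + q *s apex" "x = r *s e 1 1 + d *s apex" for p q r d
  proof -
    have nz: "apex_coeff g h 0 1 \<noteq> 0" using g h by (simp add: apex_coeff_def)
    have "y 0 1 x = q * apex_coeff g h 0 1" "y 0 1 x = d * apex_coeff g h 0 1"
      "y 0 0 x = p + q * apex_coeff g h 0 0" "y 0 0 x = d * apex_coeff g h 0 0"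
      by (subst that(1), simp) (subst that(2), simp, subst that(1), simp, subst that(2), simp)
    then show ?thesis using that(1) nz by simp
  qed
  then have 1: "P = point apex" if "P \<in> line_u \<phi> 0 0" "P \<in> line_u \<phi> 1 1"
    using that x unfolding x(2) in_line_u[OF x(1)] by (metis point_smult)
  have 2: "point apex \<in> line_u \<phi> i j" for i j
    unfolding in_line_u[OF apex_nonzero] by (rule exI[of _ 0], rule exI[of _ 1]) simp
  show "P \<in> (\<Inter>i. \<Inter>j. line_u \<phi> i j) \<longleftrightarrow> P \<in> {point apex}" using 1 2 by auto
qed

lemma pyramidal: "pyramidal \<phi>"
proof -
  have "\<forall>k. quadric_surface (surf_Y \<phi> k)"
    using quadric_surface_segre dual dual_upper
    by (auto simp: all_2' surf_Y_segre[OF dual] surf_Y_segre[OF dual_upper])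
  then show ?thesis unfolding pyramidal_def using lines_u_meet by blast
qed

lemma conclusion:
  "pyramidal \<phi> \<and>
   (let s = surf_S \<phi> 0 \<inter> surf_S \<phi> 1; t = surf_T \<phi> 0 \<inter> surf_T \<phi> 1 in
    \<exists>C. plane_conic C \<and> surf_Y \<phi> 0 \<inter> surf_Y \<phi> 1 = s \<union> t \<union> C \<and>
        C \<inter> s \<noteq> {} \<and> C \<inter> t \<noteq> {})"
  unfolding Let_def
  using pyramidal plane_conic_conic intersection_eq conic_meets_s conic_meets_t by blast


section \<open>The inverse of a map in normal form\<close>

lemma \<alpha>_trilinear:
  "lin (\<alpha> i) (trilinear \<phi> s t u)
    = (u $ 0 + \<mu> * u $ 1) * (g 0 * t $ 0 + g 1 * t $ 1) * s $ i"
  by (simp add: \<alpha>_def y_trilinear apex_coeff_def algebra_simps)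

lemma \<beta>_trilinear:
  "lin (\<beta> j) (trilinear \<phi> s t u)
    = (u $ 0 + \<mu> * u $ 1) * (h 0 * s $ 0 + h 1 * s $ 1) * t $ j"
  by (simp add: \<beta>_def y_trilinear apex_coeff_def algebra_simps)

lemma \<tau>_trilinear:
  "lin \<tau> (trilinear \<phi> s t u)
    = (u $ 0 + \<mu> * u $ 1) * (g 0 * t $ 0 + g 1 * t $ 1) * (h 0 * s $ 0 + h 1 * s $ 1)"
  by (simp add: \<tau>_lin \<alpha>_trilinear algebra_simps)

lemma \<sigma>_trilinear:
  "lin \<sigma> (trilinear \<phi> s t u) = (u $ 0 + (\<mu> + \<kappa>0) * u $ 1) * cst s t"
proof -
  have "lin \<sigma> (trilinear \<phi> s t u) = (u $ 0 + \<mu> * u $ 1) * cst s t + u $ 1 * cst s t * \<kappa>0"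
    by (simp add: \<sigma>_lin y_trilinear \<kappa>0_def sum_distrib_left sum.distrib cst_def sum_2' algebra_simps)
  then show ?thesis by (simp add: algebra_simps)
qed

lemma segre_trilinear:
  "eval (segre w) (trilinear \<phi> s t u) = (u $ 0 + \<mu> * u $ 1)
    * (g 0 * t $ 0 + g 1 * t $ 1) * (h 0 * s $ 0 + h 1 * s $ 1) * cst s t * u $ 1"
  by (simp add: eval_segre y_trilinear apex_coeff_def algebra_simps)

text \<open>Up to nonzero factors these are the equations of \<open>Y\<^sub>1\<close> and
  \<open>Y\<^sub>0\<close>, scaled so that on the image they are \<open>u $ 0\<close> and
  \<open>u $ 1\<close> times one common factor.\<close>

definition inv_C :: "2 \<Rightarrow> 4 mpoly" where
  "inv_C i = (if i = 0 then linform \<sigma> * linform \<tau> - const (\<mu> + \<kappa>0) * segre w else segre w)"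

lemma eval_inv_C:
  "eval (inv_C 0) x = lin \<sigma> x * lin \<tau> x - (\<mu> + \<kappa>0) * eval (segre w) x"
  "eval (inv_C 1) x = eval (segre w) x"
  by (simp_all add: inv_C_def)

lemma homogeneous_inv_C: "homogeneous 2 (inv_C i)"
  unfolding inv_C_def
  using homogeneous_mult[OF homogeneous_linform homogeneous_linform, of \<sigma> \<tau>]
    homogeneous_mult[OF homogeneous_const homogeneous_segre] homogeneous_segre[of w]
  by (auto intro!: homogeneous_diff simp: numeral_2_eq_2)

lemma inv_C_trilinear:
  "eval (inv_C i) (trilinear \<phi> s t u) = (u $ 0 + \<mu> * u $ 1)
    * (g 0 * t $ 0 + g 1 * t $ 1) * (h 0 * s $ 0 + h 1 * s $ 1) * cst s t * u $ i"
  by (cases i rule: exhaust_2')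
    (simp_all add: eval_inv_C \<sigma>_trilinear \<tau>_trilinear segre_trilinear algebra_simps)

text \<open>Here \<open>cst\<close> and the combination \<open>u $ 0 + \<mu> * u $ 1\<close> take
  the same value, so in \<open>y_trilinear\<close> the apex term cancels the correction term of
  \<open>\<alpha>\<beta>\<close>, and a multiple of \<open>x\<close> remains.\<close>

lemma trilinear_inverse:
  "trilinear \<phi> (\<chi> i. lin (\<alpha> i) x) (\<chi> j. lin (\<beta> j) x) (\<chi> k. eval (inv_C k) x)
    = ((lin \<sigma> x * lin \<tau> x - \<kappa>0 * eval (segre w) x) * lin \<tau> x) *s x"
proof (rule eqI)
  fix i j
  have "cst (\<chi> i. lin (\<alpha> i) x) (\<chi> j. lin (\<beta> j) x)
      = (\<Sum>k\<in>UNIV. \<Sum>l\<in>UNIV. c k l * (lin (\<alpha> k) x * lin (\<beta> l) x))"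
    by (simp add: cst_def mult.assoc)
  also have "\<dots> = lin \<sigma> x * lin \<tau> x - eval (segre w) x * \<kappa>0"
    by (simp add: \<alpha>\<beta> \<sigma>_lin \<kappa>0_def sum_2' algebra_simps)
  finally have cst: "cst (\<chi> i. lin (\<alpha> i) x) (\<chi> j. lin (\<beta> j) x)
      = lin \<sigma> x * lin \<tau> x - eval (segre w) x * \<kappa>0" .
  show "y i j (trilinear \<phi> (\<chi> i. lin (\<alpha> i) x) (\<chi> j. lin (\<beta> j) x) (\<chi> k. eval (inv_C k) x))
    = y i j (((lin \<sigma> x * lin \<tau> x - \<kappa>0 * eval (segre w) x) * lin \<tau> x) *s x)"
    by (simp add: y_trilinear cst eval_inv_C \<alpha>\<beta> algebra_simps)
qed

lemma e00: "lin (\<alpha> 0) (e 0 0) = g 0" "lin (\<beta> 0) (e 0 0) = h 0" "lin \<tau> (e 0 0) = h 0 * g 0"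
  "lin \<sigma> (e 0 0) = c 0 0" "eval (segre w) (e 0 0) = 0"
  by (simp_all add: \<alpha>_def \<beta>_def \<tau>_def \<sigma>_lin sum_2' eval_segre)

lemma is_inverse:
  "is_inverse \<phi> (\<lambda>i. linform (\<alpha> i)) (\<lambda>j. linform (\<beta> j)) inv_C"
proof -
  define a where "a = eval_pair (\<lambda>i. linform (\<alpha> i))"
  define b where "b = eval_pair (\<lambda>j. linform (\<beta> j))"
  define d where "d = eval_pair inv_C"
  define defd where "defd = (\<lambda>x. x \<noteq> 0 \<and> a x \<noteq> 0 \<and> b x \<noteq> 0 \<and> d x \<noteq> 0)"
  have f: "trilinear \<phi> (a x) (b x) (d x)
      = ((lin \<sigma> x * lin \<tau> x - \<kappa>0 * eval (segre w) x) * lin \<tau> x) *s x" for x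
    using trilinear_inverse[of x] by (simp add: a_def b_def d_def eval_pair_def)
  \<comment> \<open>At \<open>e 0 0\<close>, the image of (1:0) in all three parameters, the
    components of index 0 are \<open>g 0\<close>, \<open>h 0\<close> and
    \<open>c 0 0 * h 0 * g 0\<close>.\<close>
  have e: "defd (e 0 0)"
  proof -
    have "a (e 0 0) $ 0 \<noteq> 0" "b (e 0 0) $ 0 \<noteq> 0" "d (e 0 0) $ 0 \<noteq> 0"
      using e00 g h c by (simp_all add: a_def b_def d_def eval_pair_def eval_inv_C)
    then show ?thesis by (auto simp: defd_def)
  qed
  have "trilinear \<phi> (axis 0 1) (axis 0 1) (axis 0 1) = e 0 0"
    unfolding trilinear_Y by (simp add: sum_2' axis_def)
  then have 1: "\<exists>s t u. defd (trilinear \<phi> s t u)" using e by metis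
  have 2: "point (a (trilinear \<phi> s t u)) = point s \<and> point (b (trilinear \<phi> s t u)) = point t
      \<and> point (d (trilinear \<phi> s t u)) = point u" if "defd (trilinear \<phi> s t u)" for s t u
  proof -
    define r where "r = u $ 0 + \<mu> * u $ 1"
    define p where "p = g 0 * t $ 0 + g 1 * t $ 1"
    define q where "q = h 0 * s $ 0 + h 1 * s $ 1"
    have "a (trilinear \<phi> s t u) = (r * p) *s s" "b (trilinear \<phi> s t u) = (r * q) *s t"
      "d (trilinear \<phi> s t u) = (r * p * q * cst s t) *s u"
      by (simp_all add: a_def b_def d_def eval_pair_def vec_eq_iff r_def p_def q_def
          \<alpha>_trilinear \<beta>_trilinear inv_C_trilinear)
    then show ?thesis using that unfolding defd_def by (metis point_smult)
  qed
  have 3: "\<exists>x. defd x \<and> trilinear \<phi> (a x) (b x) (d x) \<noteq> 0"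
    by (rule exI[of _ "e 0 0"]) (use e e00 g h c in \<open>simp add: f\<close>)
  have 4: "point (trilinear \<phi> (a x) (b x) (d x)) = point x"
    if "trilinear \<phi> (a x) (b x) (d x) \<noteq> 0" for x
    using that unfolding f by (rule point_smult)
  show ?thesis
    unfolding is_inverse_def Let_def a_def[symmetric] b_def[symmetric] d_def[symmetric]
    using 1 2 3 4 unfolding defd_def by blast
qed

lemma birational: "\<phi> \<in> birational_of_type (1, 1, 2)"
proof -
  have "linform (\<alpha> 0) \<noteq> 0" "linform (\<beta> 0) \<noteq> 0"
    using e00 g h by (metis eval_0 eval_linform)+
  then have irr: "irreducible (linform (\<alpha> 0))" "irreducible (linform (\<beta> 0))"
    using homogeneous_1_irreducible homogeneous_linform by blast+
  have A: "no_common_factor (linform (\<alpha> 0)) (linform (\<alpha> 1))"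
    by (rule no_common_factorI[OF irr(1), of "e 1 0"]) (use g in \<open>simp_all add: \<alpha>_def\<close>)
  have B: "no_common_factor (linform (\<beta> 0)) (linform (\<beta> 1))"
    by (rule no_common_factorI[OF irr(2), of "e 0 1"]) (use h in \<open>simp_all add: \<beta>_def\<close>)
  \<comment> \<open>The order is reversed because \<open>inv_C 1\<close> is the Segre form, known to
    be irreducible and zero at \<open>e 0 0\<close>.\<close>
  have "no_common_factor (inv_C 1) (inv_C 0)"
    by (rule no_common_factorI[of _ "e 0 0"])
      (use irreducible_segre[OF dual] e00 g h c in \<open>simp_all add: eval_inv_C, simp add: inv_C_def\<close>)
  then have C: "no_common_factor (inv_C 0) (inv_C 1)" unfolding no_common_factor_def by blast
  show ?thesis
    unfolding birational_of_type_def prod.case mem_Collect_eq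
    by (intro exI[of _ "\<lambda>i. linform (\<alpha> i)"] exI[of _ "\<lambda>j. linform (\<beta> j)"] exI[of _ inv_C] conjI allI)
      (rule A B C is_inverse homogeneous_linform homogeneous_inv_C)+
qed

end

section \<open>Determinantal conditions\<close>

lemma two_eq_0: "(2 :: 2) = 0"
  by simp

lemma four_eq_0: "(4 :: 4) = 0"
  by simp

lemma sum_4': "sum f (UNIV :: 4 set) = f 0 + f 1 + f 2 + f 3"
  unfolding sum_4 four_eq_0 by (simp only: ac_simps)

lemma all_4': "(\<forall>n :: 4. P n) \<longleftrightarrow> P 0 \<and> P 1 \<and> P 2 \<and> P 3"
  unfolding forall_4 four_eq_0 by blast

definition row_index :: "4 \<Rightarrow> 2" where "row_index n = (if n = 0 \<or> n = 1 then 0 else 1)"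
definition col_index :: "4 \<Rightarrow> 2" where "col_index n = (if n = 0 \<or> n = 2 then 0 else 1)"
definition index :: "2 \<Rightarrow> 2 \<Rightarrow> 4" where
  "index i j = (if i = 0 then if j = 0 then 0 else 1 else if j = 0 then 2 else 3)"

definition frame :: "(2 \<Rightarrow> 2 \<Rightarrow> 'a^4) \<Rightarrow> 'a^4^4" where
  "frame v = (\<chi> n. v (row_index n) (col_index n))"

lemma index_row_col [simp]: "index (row_index n) (col_index n) = n"
proof -
  have "\<forall>n. index (row_index n) (col_index n) = n"
    by (simp add: all_4' index_def row_index_def col_index_def)
  then show ?thesis by blast
qed

lemma row_col_index [simp]: "row_index (index i j) = i" "col_index (index i j) = j"
proof -
  have "\<forall>i j. row_index (index i j) = i \<and> col_index (index i j) = j"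
    by (simp add: all_2' index_def row_index_def col_index_def)
  then show "row_index (index i j) = i" "col_index (index i j) = j" by blast+
qed

lemma sum_index: "(\<Sum>i\<in>UNIV. \<Sum>j\<in>UNIV. f i j) = (\<Sum>n\<in>UNIV. f (row_index n) (col_index n))"
  by (simp add: sum_2' sum_4' row_index_def col_index_def add.assoc)

text \<open>The dual basis consists of the columns of the inverse matrix; the two halves of
  \<open>dual_basis\<close> are the two one-sided inverse equations.\<close>

lemma dual_basis_iff_det: "(\<exists>w. dual_basis v w) \<longleftrightarrow> det (frame v) \<noteq> 0"
proof
  assume "\<exists>w. dual_basis v w"
  then obtain w where w: "dual_basis v w" by blast
  have "frame v ** transpose (frame w) = mat 1"
    using dual_basis_lin[OF w]
    by (simp add: matrix_matrix_mult_def frame_def transpose_def mat_def vec_eq_iff)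
      (metis (no_types, lifting) index_row_col lin_def mult.commute sum.cong)
  then have "det (frame v) * det (transpose (frame w)) = 1" by (metis det_I det_mul)
  then show "det (frame v) \<noteq> 0" by auto
next
  assume "det (frame v) \<noteq> 0"
  then obtain W where W: "frame v ** W = mat 1" "W ** frame v = mat 1"
    using invertible_det_nz unfolding invertible_def by blast
  define w where "w = (\<lambda>i j. column (index i j) W)"
  have "lin (w i j) (v k l) = (frame v ** W) $ index k l $ index i j" for i j k l
    by (simp add: w_def lin_def matrix_matrix_mult_def frame_def column_def mult.commute)
  then have 1: "lin (w i j) (v k l) = (if i = k \<and> j = l then 1 else 0)" for i j k l
    unfolding W by (auto simp: mat_def) (metis row_col_index)+
  have 2: "x = (\<Sum>i\<in>UNIV. \<Sum>j\<in>UNIV. lin (w i j) x *s v i j)" for x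
  proof -
    have "x $ l = (\<Sum>n\<in>UNIV. lin (column n W) x * frame v $ n $ l)" for l
    proof -
      have "(\<Sum>n\<in>UNIV. lin (column n W) x * frame v $ n $ l)
          = (\<Sum>n\<in>UNIV. \<Sum>k\<in>UNIV. x $ k * (W $ k $ n * frame v $ n $ l))"
        by (simp add: lin_def column_def sum_distrib_left mult_ac)
      also have "\<dots> = (\<Sum>k\<in>UNIV. x $ k * (W ** frame v) $ k $ l)"
        by (subst sum.swap) (simp add: matrix_matrix_mult_def sum_distrib_left)
      also have "\<dots> = (\<Sum>k\<in>UNIV. if k = l then x $ k else 0)"
        unfolding W by (intro sum.cong refl) (simp add: mat_def)
      finally show ?thesis by simp
    qed
    then show ?thesis by (simp add: sum_index vec_eq_iff w_def frame_def)
  qed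
  show "\<exists>w. dual_basis v w" unfolding dual_basis_def using 1 2 by blast
qed

text \<open>Cramer's rule. It makes a coordinate in the face basis, times the face determinant, a
  polynomial in the coefficients of the map.\<close>

lemma det_frame_replace:
  assumes "dual_basis v w"
  shows "det (frame (\<lambda>i j. if i = k \<and> j = l then p else v i j)) = lin (w k l) p * det (frame v)"
proof -
  define x :: "complex^4" where "x = (\<chi> n. lin (w (row_index n) (col_index n)) p)"
  have p: "(\<Sum>n\<in>UNIV. x $ n *s row n (frame v)) = p"
    using dual_basis_expand[OF assms, of p]
    by (simp add: sum_index x_def row_def frame_def vec_eq_iff)
  have *: "row_index n = k \<and> col_index n = l \<longleftrightarrow> n = index k l" for n
    by (metis index_row_col row_col_index)
  have "frame (\<lambda>i j. if i = k \<and> j = l then p else v i j)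
    = (\<chi> n. if n = index k l then (\<Sum>n\<in>UNIV. x $ n *s row n (frame v)) else row n (frame v))"
    unfolding p by (simp add: frame_def vec_eq_iff * row_def)
  then show ?thesis using cramer_lemma_transpose[of "index k l" x "frame v"] by (simp add: x_def)
qed

section \<open>The open set of general maps\<close>

definition gen_vec :: "2 \<Rightarrow> 2 \<Rightarrow> 2 \<Rightarrow> ((2 \<times> 2 \<times> 2 \<times> 4) mpoly)^4" where
  "gen_vec i j k = (\<chi> l. coord (i, j, k, l))"

definition face_det :: "2 \<Rightarrow> (2 \<times> 2 \<times> 2 \<times> 4) mpoly" where
  "face_det k = det (frame (\<lambda>i j. gen_vec i j k))"

text \<open>In the type \<open>2\<close>, adding 1 gives the other index. By Cramer's rule this is
  the face determinant times the opposite coordinate of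
  \<open>w\<^sub>i\<^sub>j\<^sub>1 P\<^sub>i\<^sub>j\<^sub>1\<close>, which in normal form is
  \<open>c i j\<close> times a nonzero entry of the apex.\<close>

definition opp_det :: "2 \<Rightarrow> 2 \<Rightarrow> (2 \<times> 2 \<times> 2 \<times> 4) mpoly" where
  "opp_det i j = det (frame (\<lambda>k l. if k = i + 1 \<and> l = j + 1 then gen_vec i j 1 else gen_vec k l 0))"

text \<open>In normal form this is a nonzero multiple of the determinant of \<open>c\<close>,
  because both diagonals of the apex matrix have the same product.\<close>

definition conic_det :: "(2 \<times> 2 \<times> 2 \<times> 4) mpoly" where
  "conic_det = opp_det 0 0 * opp_det 1 1 - opp_det 0 1 * opp_det 1 0"

definition general :: "trilinear_map set" where
  "general = {\<phi>. \<forall>p \<in> {conic_det} \<union> range face_det \<union> range (\<lambda>(i, j). opp_det i j).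
     eval p (coords \<phi>) \<noteq> 0}"

lemma homogeneous_frame:
  "(\<And>i j l. homogeneous 1 (v i j $ l)) \<Longrightarrow> homogeneous 4 (det (frame v))"
  using homogeneous_det[of "frame v"] by (simp add: frame_def)

lemma homogeneous_gen_vec: "homogeneous 1 (gen_vec i j k $ l)"
  by (simp add: gen_vec_def homogeneous_coord del: One_nat_def)

lemma zariski_open_general: "zariski_open general"
proof -
  have "homogeneous 4 (opp_det i j)" "homogeneous 4 (face_det k)" for i j k
    unfolding opp_det_def face_det_def
    by (auto intro!: homogeneous_frame simp: homogeneous_gen_vec simp del: One_nat_def)
  moreover from this have "homogeneous (4 + 4) conic_det"
    unfolding conic_det_def by (intro homogeneous_diff homogeneous_mult)
  ultimately show ?thesis
    unfolding general_def by (intro zariski_open_nonvanishing) auto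
qed

lemma eval_frame:
  "eval (det (frame v)) x = det (frame (\<lambda>i j. \<chi> l. eval (v i j $ l) x))"
  by (simp add: frame_def)

lemma eval_face_det: "eval (face_det k) (coords \<phi>) = det (frame (\<lambda>i j. coeff_vec \<phi> i j k))"
  unfolding face_det_def eval_frame by (simp add: gen_vec_def coeff_vec_def)

lemma eval_opp_det:
  assumes "dual_basis (\<lambda>i j. coeff_vec \<phi> i j 0) w"
  shows "eval (opp_det i j) (coords \<phi>)
    = lin (w (i + 1) (j + 1)) (coeff_vec \<phi> i j 1) * det (frame (\<lambda>i j. coeff_vec \<phi> i j 0))"
proof -
  have "eval (opp_det i j) (coords \<phi>)
    = det (frame (\<lambda>k l. if k = i + 1 \<and> l = j + 1 then coeff_vec \<phi> i j 1 else coeff_vec \<phi> k l 0))"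
    unfolding opp_det_def eval_frame
    by (intro arg_cong[of _ _ det] arg_cong[of _ _ frame] ext)
      (simp add: gen_vec_def coeff_vec_def vec_eq_iff)
  also have "\<dots> = lin (w (i + 1) (j + 1)) (coeff_vec \<phi> i j 1) * det (frame (\<lambda>i j. coeff_vec \<phi> i j 0))"
    by (rule det_frame_replace[OF assms])
  finally show ?thesis .
qed

lemma general_iff:
  assumes "dual_basis (\<lambda>i j. coeff_vec \<phi> i j 0) w"
  defines "M \<equiv> \<lambda>i j. lin (w (i + 1) (j + 1)) (coeff_vec \<phi> i j 1)"
  shows "\<phi> \<in> general \<longleftrightarrow> det (frame (\<lambda>i j. coeff_vec \<phi> i j 1)) \<noteq> 0 \<and> (\<forall>i j. M i j \<noteq> 0)
    \<and> M 0 0 * M 1 1 \<noteq> M 0 1 * M 1 0"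
proof -
  define d where "d = det (frame (\<lambda>i j. coeff_vec \<phi> i j 0))"
  have d: "d \<noteq> 0" using assms(1) dual_basis_iff_det unfolding d_def by blast
  have opp: "eval (opp_det i j) (coords \<phi>) = M i j * d" for i j
    unfolding M_def d_def by (rule eval_opp_det[OF assms(1)])
  have "eval conic_det (coords \<phi>) = (M 0 0 * M 1 1 - M 0 1 * M 1 0) * (d * d)"
    by (simp add: conic_det_def opp algebra_simps)
  then have "eval conic_det (coords \<phi>) \<noteq> 0 \<longleftrightarrow> M 0 0 * M 1 1 \<noteq> M 0 1 * M 1 0" using d by simp
  moreover have "\<phi> \<in> general \<longleftrightarrow> eval conic_det (coords \<phi>) \<noteq> 0
      \<and> (\<forall>k. eval (face_det k) (coords \<phi>) \<noteq> 0) \<and> (\<forall>i j. eval (opp_det i j) (coords \<phi>) \<noteq> 0)"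
    by (auto simp: general_def)
  moreover have "(\<forall>k. eval (face_det k) (coords \<phi>) \<noteq> 0)
      \<longleftrightarrow> det (frame (\<lambda>i j. coeff_vec \<phi> i j 1)) \<noteq> 0"
    using d unfolding eval_face_det all_2'[of "\<lambda>k. det (frame (\<lambda>i j. coeff_vec \<phi> i j k)) \<noteq> 0"]
    by (simp add: d_def)
  ultimately show ?thesis using d by (simp add: opp) blast
qed

lemma (in normal_form) in_general: "\<phi> \<in> general"
proof -
  have nz: "apex_coeff g h k l \<noteq> 0" for k l using g h by (simp add: apex_coeff_def)
  define M where "M = (\<lambda>i j. lin (w (i + 1) (j + 1)) (coeff_vec \<phi> i j 1))"
  have M: "M i j = c i j * apex_coeff g h (i + 1) (j + 1)" for i j
    by (simp add: M_def y_upper)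
  have "(M 0 0 * M 1 1 - M 0 1 * M 1 0)
      = (c 0 0 * c 1 1 - c 0 1 * c 1 0) * (g 0 * g 1 * h 0 * h 1)"
    by (simp add: M apex_coeff_def algebra_simps)
  then have "M 0 0 * M 1 1 - M 0 1 * M 1 0 \<noteq> 0" using det_c g h by simp
  moreover have "M i j \<noteq> 0" for i j using c nz by (simp add: M)
  ultimately show ?thesis
    using general_iff[OF dual] dual_basis_iff_det dual_upper unfolding M_def by auto
qed

section \<open>Reduction to the normal form\<close>

lemma trilinear_component:
  "trilinear \<phi> s t u $ l
    = (\<Sum>i\<in>UNIV. \<Sum>j\<in>UNIV. \<Sum>k\<in>UNIV. s $ i * t $ j * u $ k * coeff_vec \<phi> i j k $ l)"
  by (simp add: trilinear_def)

text \<open>The inverse recovers s and t only where it is defined. On the line from an arbitrary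
  parameter triple to one good triple, the proportionality becomes a polynomial identity and so
  holds at the start as well.\<close>

lemma birational_factors:
  assumes "\<phi> \<in> birational_of_type (1, 1, n)"
  obtains a0 a1 b0 b1 where
    "\<And>s t u. lin a0 (trilinear \<phi> s t u) * s $ 1 = lin a1 (trilinear \<phi> s t u) * s $ 0"
    "\<And>s t u. lin b0 (trilinear \<phi> s t u) * t $ 1 = lin b1 (trilinear \<phi> s t u) * t $ 0"
    "\<exists>x. lin a0 x \<noteq> 0 \<or> lin a1 x \<noteq> 0" "\<exists>x. lin b0 x \<noteq> 0 \<or> lin b1 x \<noteq> 0"
proof -
  obtain A B C where hom: "\<And>i. homogeneous 1 (A i)" "\<And>j. homogeneous 1 (B j)"
    and inv: "is_inverse \<phi> A B C"
    using assms unfolding birational_of_type_def by auto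
  define f where "f = trilinear \<phi>"
  define defd where
    "defd = (\<lambda>x. x \<noteq> 0 \<and> eval_pair A x \<noteq> 0 \<and> eval_pair B x \<noteq> 0 \<and> eval_pair C x \<noteq> 0)"
  have ex: "\<exists>s t u. defd (f s t u)"
    and inverts: "\<And>s t u. defd (f s t u) \<Longrightarrow>
      point (eval_pair A (f s t u)) = point s \<and> point (eval_pair B (f s t u)) = point t"
    using inv unfolding is_inverse_def Let_def defd_def f_def by blast+
  obtain s0 t0 u0 where 0: "defd (f s0 t0 u0)" using ex by blast
  obtain i j k l where nz: "f s0 t0 u0 $ l \<noteq> 0" "eval (A i) (f s0 t0 u0) \<noteq> 0"
    "eval (B j) (f s0 t0 u0) \<noteq> 0" "eval (C k) (f s0 t0 u0) \<noteq> 0"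
    using 0 by (auto simp: defd_def eval_pair_def vec_eq_iff)
  have par: "p $ 0 * q $ 1 = p $ 1 * q $ 0" if "point p = point q" "p \<noteq> 0" "q \<noteq> 0" for p q :: "complex^2"
  proof -
    have "\<exists>c. q = c *s p" using point_eq_iff[OF that(2,3)] that(1) by auto
    then obtain c where "q = c *s p" by blast
    then show ?thesis by (simp add: mult_ac)
  qed
  have *: "eval (A 0) (f s t u) * s $ 1 = eval (A 1) (f s t u) * s $ 0 \<and>
      eval (B 0) (f s t u) * t $ 1 = eval (B 1) (f s t u) * t $ 0" for s t u
  proof -
    define S where "S = (\<lambda>z. s + z *s (s0 - s))"
    define T where "T = (\<lambda>z. t + z *s (t0 - t))"
    define U where "U = (\<lambda>z. u + z *s (u0 - u))"
    define F where "F = (\<lambda>z. f (S z) (T z) (U z))"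
    have S: "poly_fun (\<lambda>z. S z $ i)" and T: "poly_fun (\<lambda>z. T z $ i)" and U: "poly_fun (\<lambda>z. U z $ i)" for i
      unfolding S_def T_def U_def by (simp_all, (intro poly_fun_intros)+)
    have F: "poly_fun (\<lambda>z. F z $ l)" for l
      unfolding F_def f_def trilinear_component by (intro poly_fun_intros S T U)
    \<comment> \<open>One coordinate of each vector that must not vanish: \<open>H z\<close> nonzero
      implies \<open>defd (F z)\<close>, and \<open>H 1\<close> is nonzero by the choice of the good
      triple.\<close>
    define H where "H = (\<lambda>z. F z $ l * eval (A i) (F z) * eval (B j) (F z) * eval (C k) (F z))"
    have H: "poly_fun H" unfolding H_def by (intro poly_fun_intros F)
    have H1: "H 1 \<noteq> 0" using nz by (simp add: H_def F_def S_def T_def U_def)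
    define GA where "GA = (\<lambda>z. eval (A 0) (F z) * S z $ 1 - eval (A 1) (F z) * S z $ 0)"
    define GB where "GB = (\<lambda>z. eval (B 0) (F z) * T z $ 1 - eval (B 1) (F z) * T z $ 0)"
    have G: "poly_fun GA" "poly_fun GB" unfolding GA_def GB_def by (intro poly_fun_intros F S T)+
    have "GA z * H z = 0 \<and> GB z * H z = 0" for z
    proof (cases "H z = 0")
      case False
      then have d: "defd (F z)" by (auto simp: H_def defd_def eval_pair_def vec_eq_iff)
      have "F z \<noteq> 0" using d by (simp add: defd_def)
      moreover have "F z = 0" if "S z = 0 \<or> T z = 0"
        using that by (auto simp: F_def f_def trilinear_component vec_eq_iff)
      ultimately have "S z \<noteq> 0" "T z \<noteq> 0" by auto
      then have "eval_pair A (F z) $ 0 * S z $ 1 = eval_pair A (F z) $ 1 * S z $ 0"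
        "eval_pair B (F z) $ 0 * T z $ 1 = eval_pair B (F z) $ 1 * T z $ 0"
        using inverts d par unfolding F_def defd_def by blast+
      then show ?thesis by (simp add: GA_def GB_def eval_pair_def)
    qed simp
    then have "GA 0 = 0" "GB 0 = 0" using poly_fun_cancel[OF _ H H1] G by blast+
    then show ?thesis by (simp add: GA_def GB_def F_def S_def T_def U_def)
  qed
  have "\<exists>w. \<forall>x. eval (A i) x = lin w x" for i
    using homogeneous_1_eval[OF hom(1)[of i]] by blast
  then obtain a where a: "\<And>i x. eval (A i) x = lin (a i) x" by metis
  have "\<exists>w. \<forall>x. eval (B j) x = lin w x" for j
    using homogeneous_1_eval[OF hom(2)[of j]] by blast
  then obtain b where b: "\<And>j x. eval (B j) x = lin (b j) x" by metis
  have "\<exists>x. lin (a 0) x \<noteq> 0 \<or> lin (a 1) x \<noteq> 0" "\<exists>x. lin (b 0) x \<noteq> 0 \<or> lin (b 1) x \<noteq> 0"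
    using nz(2,3) by (cases i rule: exhaust_2'; cases j rule: exhaust_2'; auto simp: a b)+
  then show thesis
    using * by (intro that[of "a 0" "a 1" "b 0" "b 1"]) (simp_all add: a b f_def)
qed

lemma trilinear_axis: "trilinear \<phi> (axis i 1) (axis j 1) (axis k 1) = coeff_vec \<phi> i j k"
proof -
  have "\<forall>i j. trilinear \<phi> (axis i 1) (axis j 1) (axis k 1) = coeff_vec \<phi> i j k"
    unfolding trilinear_Y by (simp add: sum_2' all_2' axis_def)
  then show ?thesis by blast
qed

lemma trilinear_add:
  "trilinear \<phi> (s + s') t u = trilinear \<phi> s t u + trilinear \<phi> s' t u"
  "trilinear \<phi> s (t + t') u = trilinear \<phi> s t u + trilinear \<phi> s t' u"
  by (simp_all add: trilinear_def sum_2' vec_eq_iff algebra_simps)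

text \<open>The two axis vectors and their sum extract the coefficients of the identities of
  \<open>birational_factors\<close>, which are quadratic in s or in t.\<close>

lemma birational_coeffs:
  assumes "\<phi> \<in> birational_of_type (1, 1, n)"
  obtains a0 a1 b0 b1 where
    "\<And>j k. lin a0 (coeff_vec \<phi> 1 j k) = 0" "\<And>j k. lin a1 (coeff_vec \<phi> 0 j k) = 0"
    "\<And>j k. lin a1 (coeff_vec \<phi> 1 j k) = lin a0 (coeff_vec \<phi> 0 j k)"
    "\<And>i k. lin b0 (coeff_vec \<phi> i 1 k) = 0" "\<And>i k. lin b1 (coeff_vec \<phi> i 0 k) = 0"
    "\<And>i k. lin b1 (coeff_vec \<phi> i 1 k) = lin b0 (coeff_vec \<phi> i 0 k)"
    "\<exists>x. lin a0 x \<noteq> 0 \<or> lin a1 x \<noteq> 0" "\<exists>x. lin b0 x \<noteq> 0 \<or> lin b1 x \<noteq> 0"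
proof -
  obtain a0 a1 b0 b1 where
    a: "\<And>s t u. lin a0 (trilinear \<phi> s t u) * s $ 1 = lin a1 (trilinear \<phi> s t u) * s $ 0"
    and b: "\<And>s t u. lin b0 (trilinear \<phi> s t u) * t $ 1 = lin b1 (trilinear \<phi> s t u) * t $ 0"
    and nz: "\<exists>x. lin a0 x \<noteq> 0 \<or> lin a1 x \<noteq> 0" "\<exists>x. lin b0 x \<noteq> 0 \<or> lin b1 x \<noteq> 0"
    by (rule birational_factors[OF assms]) (rule that)
  have a0: "lin a0 (coeff_vec \<phi> 1 j k) = 0" and a1: "lin a1 (coeff_vec \<phi> 0 j k) = 0" for j k
    using a[of "axis 1 1" "axis j 1" "axis k 1"] a[of "axis 0 1" "axis j 1" "axis k 1"]
    unfolding trilinear_axis by (simp_all add: axis_def)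
  have a01: "lin a1 (coeff_vec \<phi> 1 j k) = lin a0 (coeff_vec \<phi> 0 j k)" for j k
    using a[of "axis 0 1 + axis 1 1" "axis j 1" "axis k 1"]
    unfolding trilinear_add trilinear_axis by (simp add: axis_def a0 a1)
  have b0: "lin b0 (coeff_vec \<phi> i 1 k) = 0" and b1: "lin b1 (coeff_vec \<phi> i 0 k) = 0" for i k
    using b[of "axis i 1" "axis 1 1" "axis k 1"] b[of "axis i 1" "axis 0 1" "axis k 1"]
    unfolding trilinear_axis by (simp_all add: axis_def)
  have b01: "lin b1 (coeff_vec \<phi> i 1 k) = lin b0 (coeff_vec \<phi> i 0 k)" for i k
    using b[of "axis i 1" "axis 0 1 + axis 1 1" "axis k 1"]
    unfolding trilinear_add trilinear_axis by (simp add: axis_def b0 b1)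
  show thesis by (rule that[OF a0 a1 a01 b0 b1 b01 nz])
qed

lemma general_birational_imp_normal_form:
  assumes "\<phi> \<in> general" "\<phi> \<in> birational_of_type (1, 1, n)"
  shows "\<exists>w c g h \<mu>. normal_form \<phi> w c g h \<mu>"
proof -
  define e where "e = (\<lambda>i j. coeff_vec \<phi> i j 0)"
  define f where "f = (\<lambda>i j. coeff_vec \<phi> i j 1)"
  have "eval (face_det 0) (coords \<phi>) \<noteq> 0" "eval (face_det 1) (coords \<phi>) \<noteq> 0"
    using assms(1) by (auto simp: general_def)
  then obtain w w' where dual: "dual_basis e w" and dual': "dual_basis f w'"
    unfolding eval_face_det dual_basis_iff_det[symmetric] e_def f_def by blast
  note [simp] = dual_basis_lin[OF dual]
  define M where "M = (\<lambda>i j k l. lin (w k l) (f i j))"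
  have opp: "\<forall>i j. M i j (i + 1) (j + 1) \<noteq> 0"
    and opp': "M 0 0 1 1 * M 1 1 0 0 \<noteq> M 0 1 1 0 * M 1 0 0 1"
    using general_iff[of \<phi> w] dual assms(1) by (auto simp: M_def f_def e_def two_eq_0)
  have M_nz: "M 0 0 1 1 \<noteq> 0" "M 0 1 1 0 \<noteq> 0" "M 1 0 0 1 \<noteq> 0" "M 1 1 0 0 \<noteq> 0"
    using opp by (simp_all add: all_2' two_eq_0)
  obtain a0 a1 b0 b1 where
    a: "\<And>j k. lin a0 (coeff_vec \<phi> 1 j k) = 0" "\<And>j k. lin a1 (coeff_vec \<phi> 0 j k) = 0"
    "\<And>j k. lin a1 (coeff_vec \<phi> 1 j k) = lin a0 (coeff_vec \<phi> 0 j k)"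
    and b: "\<And>i k. lin b0 (coeff_vec \<phi> i 1 k) = 0" "\<And>i k. lin b1 (coeff_vec \<phi> i 0 k) = 0"
    "\<And>i k. lin b1 (coeff_vec \<phi> i 1 k) = lin b0 (coeff_vec \<phi> i 0 k)"
    and nz: "\<exists>x. lin a0 x \<noteq> 0 \<or> lin a1 x \<noteq> 0" "\<exists>x. lin b0 x \<noteq> 0 \<or> lin b1 x \<noteq> 0"
    by (rule birational_coeffs[OF assms(2)]) (rule that)
  define g where "g = (\<lambda>j. lin a0 (e 0 j))"
  define h where "h = (\<lambda>i. lin b0 (e i 0))"
  \<comment> \<open>The form \<open>a0\<close> lives on row 0 and \<open>a1\<close> on row 1, with
    the same coefficients \<open>g\<close>; likewise \<open>b0\<close> and \<open>b1\<close> live on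
    the columns with coefficients \<open>h\<close>.\<close>
  have a_eq: "lin a0 x = g 0 * lin (w 0 0) x + g 1 * lin (w 0 1) x"
    "lin a1 x = g 0 * lin (w 1 0) x + g 1 * lin (w 1 1) x" for x
    using a by (subst dual_basis_expand[OF dual, of x], simp add: sum_2' g_def e_def mult.commute)+
  have b_eq: "lin b0 x = h 0 * lin (w 0 0) x + h 1 * lin (w 1 0) x"
    "lin b1 x = h 0 * lin (w 0 1) x + h 1 * lin (w 1 1) x" for x
    using b by (subst dual_basis_expand[OF dual, of x], simp add: sum_2' h_def e_def mult.commute)+
  have aM: "g 0 * M 1 j 0 0 + g 1 * M 1 j 0 1 = 0" "g 0 * M 0 j 1 0 + g 1 * M 0 j 1 1 = 0"
    "g 0 * M 0 j 0 0 + g 1 * M 0 j 0 1 = g 0 * M 1 j 1 0 + g 1 * M 1 j 1 1" for j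
    using a[of j 1] unfolding a_eq by (simp_all add: M_def f_def)
  have bM: "h 0 * M i 1 0 0 + h 1 * M i 1 1 0 = 0" "h 0 * M i 0 0 1 + h 1 * M i 0 1 1 = 0"
    "h 0 * M i 0 0 0 + h 1 * M i 0 1 0 = h 0 * M i 1 0 1 + h 1 * M i 1 1 1" for i
    using b[of i 1] unfolding b_eq by (simp_all add: M_def f_def)
  \<comment> \<open>The nonzero opposite entries of \<open>M\<close> make \<open>g 0\<close> and
    \<open>g 1\<close> vanish together, and then both \<open>a0\<close> and \<open>a1\<close> would
    vanish identically.\<close>
  have g: "g 0 \<noteq> 0" "g 1 \<noteq> 0"
    using nz(1) aM(2)[of 0] aM(2)[of 1] M_nz unfolding a_eq by auto
  have h: "h 0 \<noteq> 0" "h 1 \<noteq> 0"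
    using nz(2) bM(2)[of 0] bM(2)[of 1] M_nz unfolding b_eq by auto
  define o' where "o' = apex_coeff g h"
  have o': "o' 0 0 = h 1 * g 1" "o' 0 1 = - (h 1 * g 0)" "o' 1 0 = - (h 0 * g 1)" "o' 1 1 = h 0 * g 0"
    by (simp_all add: o'_def apex_coeff_def)
  have o'_nz: "o' i j \<noteq> 0" for i j
    using g h by (cases i rule: exhaust_2'; cases j rule: exhaust_2') (simp_all add: o')
  define c where "c = (\<lambda>i j. M i j (i + 1) (j + 1) / o' (i + 1) (j + 1))"
  have c_nz: "c i j \<noteq> 0" for i j using opp o'_nz by (simp add: c_def)
  have c: "M 0 0 1 1 = c 0 0 * o' 1 1" "M 0 1 1 0 = c 0 1 * o' 1 0"
    "M 1 0 0 1 = c 1 0 * o' 0 1" "M 1 1 0 0 = c 1 1 * o' 0 0"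
    using o'_nz by (simp_all add: c_def two_eq_0)
  have det_c: "c 0 0 * c 1 1 \<noteq> c 0 1 * c 1 0"
  proof
    assume "c 0 0 * c 1 1 = c 0 1 * c 1 0"
    then have "(c 0 0 * c 1 1) * (g 0 * g 1 * h 0 * h 1) = (c 0 1 * c 1 0) * (g 0 * g 1 * h 0 * h 1)"
      by simp
    then show False using opp' by (simp add: c o' mult_ac)
  qed
  \<comment> \<open>The apex is annihilated by \<open>g\<close> and \<open>h\<close>, so
    \<open>D\<close> satisfies the same equations as \<open>M\<close>. Its opposite entries vanish
    by the choice of \<open>c\<close>; the equations spread this to every entry off the diagonal and
    equate the four diagonal ones.\<close>
  define D where "D = (\<lambda>i j k l. M i j k l - c i j * o' k l)"
  have D0: "D 0 0 1 1 = 0" "D 0 1 1 0 = 0" "D 1 0 0 1 = 0" "D 1 1 0 0 = 0"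
    by (simp_all add: D_def c)
  have aD: "g 0 * D 1 j 0 0 + g 1 * D 1 j 0 1 = 0" "g 0 * D 0 j 1 0 + g 1 * D 0 j 1 1 = 0"
    "g 0 * D 0 j 0 0 + g 1 * D 0 j 0 1 = g 0 * D 1 j 1 0 + g 1 * D 1 j 1 1" for j
    using aM[of j] by (simp_all add: D_def o' algebra_simps)
  have bD: "h 0 * D i 1 0 0 + h 1 * D i 1 1 0 = 0" "h 0 * D i 0 0 1 + h 1 * D i 0 1 1 = 0"
    "h 0 * D i 0 0 0 + h 1 * D i 0 1 0 = h 0 * D i 1 0 1 + h 1 * D i 1 1 1" for i
    using bM[of i] by (simp_all add: D_def o' algebra_simps)
  define \<mu> where "\<mu> = D 0 0 0 0"
  have D1: "D 0 0 1 0 = 0" "D 0 1 1 1 = 0" "D 1 0 0 0 = 0" "D 1 1 0 1 = 0"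
    using aD(1,2)[of 0] aD(1,2)[of 1] D0 g by auto
  have D2: "D 0 0 0 1 = 0" "D 1 0 1 1 = 0" "D 0 1 0 0 = 0" "D 1 1 1 0 = 0"
    using bD(1,2)[of 0] bD(1,2)[of 1] D0 h by auto
  have D3: "D 1 0 1 0 = \<mu>" "D 0 1 0 1 = \<mu>" "D 1 1 1 1 = \<mu>"
    using aD(3)[of 0] bD(3)[of 0] aD(3)[of 1] D1 D2 g h by (auto simp: \<mu>_def)
  have "\<forall>i j k l. D i j k l = (if k = i \<and> l = j then \<mu> else 0)"
    using D0 D1 D2 D3 by (simp add: all_2' \<mu>_def)
  then have M: "M i j k l = (if k = i \<and> l = j then \<mu> else 0) + c i j * o' k l" for i j k l
    by (simp add: D_def algebra_simps)
  have lin_o: "lin (w k l) (\<Sum>k\<in>UNIV. \<Sum>l\<in>UNIV. o' k l *s e k l) = o' k l" for k l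
  proof -
    have "\<forall>k l. lin (w k l) (\<Sum>k\<in>UNIV. \<Sum>l\<in>UNIV. o' k l *s e k l) = o' k l"
      by (simp add: sum_2' all_2')
    then show ?thesis by blast
  qed
  have f: "f i j = \<mu> *s e i j + c i j *s (\<Sum>k\<in>UNIV. \<Sum>l\<in>UNIV. o' k l *s e k l)" for i j
  proof (rule dual_basis_eqI[OF dual])
    fix k l
    show "lin (w k l) (f i j)
        = lin (w k l) (\<mu> *s e i j + c i j *s (\<Sum>k\<in>UNIV. \<Sum>l\<in>UNIV. o' k l *s e k l))"
      unfolding lin_add lin_smult lin_o using M[of i j k l] by (simp add: M_def)
  qed
  define p where "p = (\<Sum>k\<in>UNIV. \<Sum>l\<in>UNIV. o' k l *s e k l)"
  have f': "f i j = \<mu> *s e i j + c i j *s p" for i j using f by (simp add: p_def)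
  \<comment> \<open>Otherwise all four vectors \<open>f i j\<close> would be multiples of
    \<open>p\<close>.\<close>
  have "\<mu> \<noteq> 0"
  proof
    assume "\<mu> = 0"
    then have "lin (w' 0 0) (f 0 0) = c 0 0 * lin (w' 0 0) p" "lin (w' 0 0) (f 0 1) = c 0 1 * lin (w' 0 0) p"
      by (simp_all add: f')
    then show False using c_nz by (simp add: dual_basis_lin[OF dual'])
  qed
  \<comment> \<open>This scalar times \<open>p\<close> is the combination of the
    \<open>f i j\<close> with the nonzero coefficients \<open>o' i j\<close>, so its vanishing would
    be a linear relation.\<close>
  moreover have "\<mu> + (\<Sum>i\<in>UNIV. \<Sum>j\<in>UNIV. c i j * o' i j) \<noteq> 0"
  proof
    assume 0: "\<mu> + (\<Sum>i\<in>UNIV. \<Sum>j\<in>UNIV. c i j * o' i j) = 0"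
    have "(\<Sum>i\<in>UNIV. \<Sum>j\<in>UNIV. o' i j *s f i j)
        = \<mu> *s p + (\<Sum>i\<in>UNIV. \<Sum>j\<in>UNIV. c i j * o' i j) *s p"
      by (simp add: f' p_def[symmetric] sum_2') (simp add: p_def sum_2' vec_eq_iff algebra_simps)
    also have "\<dots> = 0" using 0 by (simp flip: vector_sadd_rdistrib)
    finally have "lin (w' 0 0) (\<Sum>i\<in>UNIV. \<Sum>j\<in>UNIV. o' i j *s f i j) = 0" by simp
    then have "o' 0 0 = 0" by (simp add: sum_2' dual_basis_lin[OF dual'])
    then show False using o'_nz by simp
  qed
  moreover have "g i \<noteq> 0" "h i \<noteq> 0" for i
    using g h by (cases i rule: exhaust_2'; simp)+
  ultimately have "normal_form \<phi> w c g h \<mu>"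
    using dual f c_nz det_c unfolding o'_def e_def f_def by unfold_locales auto
  then show ?thesis by blast
qed

section \<open>A real general map\<close>

definition base_point :: "2 \<Rightarrow> 2 \<Rightarrow> real^4" where
  "base_point i j = (\<chi> l. if l = 0 \<or> l = index i j then 1 else 0)"

text \<open>The single entry 2 makes the determinant of the coefficient matrix 1; with all entries 1
  it would be 0.\<close>

definition example_coeff :: "2 \<Rightarrow> 2 \<Rightarrow> real" where
  "example_coeff i j = (if i = 1 \<and> j = 1 then 2 else 1)"

text \<open>The normal form with \<mu>, \<open>g\<close> and \<open>h\<close> all 1. The added
  alternating sum is the apex; its coordinate of index 0 is zero, so the points stay in the affine
  chart.\<close>

definition example_point :: "2 \<Rightarrow> 2 \<Rightarrow> 2 \<Rightarrow> real^4" where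
  "example_point i j k = base_point i j + (if k = 0 then 0 else example_coeff i j) *s
     (base_point 0 0 - base_point 0 1 - base_point 1 0 + base_point 1 1)"

definition example_map :: trilinear_map where
  "example_map = point (vec_lambda (\<lambda>(i, j, k, l). complex_of_real (example_point i j k $ l)))"

lemma example_map_real: "example_map \<in> real_trilinear_maps"
proof -
  have "example_point i j k $ 0 = 1" for i j k
    by (simp add: example_point_def base_point_def)
  then show ?thesis
    unfolding real_trilinear_maps_def example_map_def
    by (intro CollectI exI[of _ "\<lambda>_ _ _. 1"] exI[of _ example_point]) simp
qed

lemma example_map_normal_form:
  "\<exists>w c g h \<mu>. normal_form example_map w c g h \<mu>"
proof -
  define v :: "complex^(2 \<times> 2 \<times> 2 \<times> 4)" where
    "v = vec_lambda (\<lambda>(i, j, k, l). complex_of_real (example_point i j k $ l))"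
  have "v $ (0, 0, 0, 0) \<noteq> 0" by (simp add: v_def example_point_def base_point_def)
  then have "v \<noteq> 0" by auto
  then obtain r where r: "r \<noteq> 0" "coords example_map = r *s v"
    unfolding example_map_def v_def[symmetric] by (rule coords_point)
  define p where "p = (\<lambda>i j k. \<chi> l. complex_of_real (example_point i j k $ l))"
  have coeff: "coeff_vec example_map i j k = r *s p i j k" for i j k
    by (simp add: coeff_vec_def r v_def p_def vec_eq_iff)
  \<comment> \<open>Barycentric coordinates for the origin and the three unit points of the
    chart.\<close>
  define w0 :: "2 \<Rightarrow> 2 \<Rightarrow> complex^4" where
    "w0 = (\<lambda>i j. \<chi> l. if l = index i j then 1 else if index i j = 0 then - 1 else 0)"
  have p0: "p i j 0 $ l = (if l = 0 \<or> l = index i j then 1 else 0)" for i j l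
    by (simp add: p_def example_point_def base_point_def)
  have lin: "lin (w0 i j) x = (if index i j = 0 then x $ 0 - x $ 1 - x $ 2 - x $ 3 else x $ index i j)" for i j x
  proof -
    have "\<forall>i j. lin (w0 i j) x = (if index i j = 0 then x $ 0 - x $ 1 - x $ 2 - x $ 3 else x $ index i j)"
      by (simp add: all_2' index_def lin_def sum_4' w0_def)
    then show ?thesis by blast
  qed
  have "dual_basis (\<lambda>i j. p i j 0) w0"
    unfolding dual_basis_def
  proof (intro conjI)
    show "\<forall>i j k l. lin (w0 i j) (p k l 0) = (if i = k \<and> j = l then 1 else 0)"
      unfolding lin p0 by (simp add: all_2' index_def)
    show "\<forall>x. x = (\<Sum>i\<in>UNIV. \<Sum>j\<in>UNIV. lin (w0 i j) x *s p i j 0)"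
      unfolding lin by (simp add: vec_eq_iff p0 sum_2' index_def all_4')
  qed
  \<comment> \<open>The coordinates of the map are fixed only up to the factor \<open>r\<close>, so
    the dual basis is rescaled by its inverse.\<close>
  then have "dual_basis (\<lambda>i j. coeff_vec example_map i j 0) (\<lambda>i j. inverse r *s w0 i j)"
  proof -
    have r': "inverse r * a * r = a" for a using r(1) by simp
    show ?thesis
      using \<open>dual_basis (\<lambda>i j. p i j 0) w0\<close> r(1)
      by (simp add: dual_basis_def coeff vector_smult_assoc r')
  qed
  moreover have "coeff_vec example_map i j 1 = 1 *s coeff_vec example_map i j 0
      + of_real (example_coeff i j) *s (\<Sum>k\<in>UNIV. \<Sum>l\<in>UNIV.
        apex_coeff (\<lambda>_. 1) (\<lambda>_. 1) k l *s coeff_vec example_map k l 0)" for i j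
    unfolding coeff
    by (simp add: sum_2' apex_coeff_def vec_eq_iff p_def example_point_def algebra_simps)
  ultimately have "normal_form example_map (\<lambda>i j. inverse r *s w0 i j)
      (\<lambda>i j. of_real (example_coeff i j)) (\<lambda>_. 1) (\<lambda>_. 1) 1"
    by unfold_locales (simp_all add: example_coeff_def apex_coeff_def sum_2')
  then show ?thesis by blast
qed

theorem proposition4p2:
  shows "\<exists>U :: trilinear_map set. zariski_open U \<and>
    U \<inter> birational_of_type (1, 1, 2) \<inter> real_trilinear_maps \<noteq> {} \<and>
    (\<forall>\<phi> \<in> U \<inter> birational_of_type (1, 1, 2).
       pyramidal \<phi> \<and>
       (let s = surf_S \<phi> 0 \<inter> surf_S \<phi> 1; t = surf_T \<phi> 0 \<inter> surf_T \<phi> 1 in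
        \<exists>C. plane_conic C \<and> surf_Y \<phi> 0 \<inter> surf_Y \<phi> 1 = s \<union> t \<union> C \<and>
            C \<inter> s \<noteq> {} \<and> C \<inter> t \<noteq> {}))"
proof (intro exI[of _ general] conjI ballI)
  show "zariski_open general" by (rule zariski_open_general)
  \<comment> \<open>The real example shows that the open set meets the locus of the type (1, 1,
    2).\<close>
  have "example_map \<in> general \<inter> birational_of_type (1, 1, 2)"
    using example_map_normal_form normal_form.in_general normal_form.birational by blast
  then show "general \<inter> birational_of_type (1, 1, 2) \<inter> real_trilinear_maps \<noteq> {}"
    using example_map_real by blast
  fix \<phi> assume "\<phi> \<in> general \<inter> birational_of_type (1, 1, 2)"
  then obtain w c g h \<mu> where "normal_form \<phi> w c g h \<mu>"
    using general_birational_imp_normal_form by blast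
  then show "pyramidal \<phi>"
    "let s = surf_S \<phi> 0 \<inter> surf_S \<phi> 1; t = surf_T \<phi> 0 \<inter> surf_T \<phi> 1 in
      \<exists>C. plane_conic C \<and> surf_Y \<phi> 0 \<inter> surf_Y \<phi> 1 = s \<union> t \<union> C \<and>
          C \<inter> s \<noteq> {} \<and> C \<inter> t \<noteq> {}"
    using normal_form.conclusion by blast+
qed

end
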